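(* Let $2<p<\infty$. There is a constant $K_p>0$, depending only on $p$, such that for every integer $m\ge 2$ and every set $A\subset\{0,1,2,\dots\}$ of cardinality $m$, the $X$-Greedy Algorithm and the Dual Greedy Algorithm for the dictionary $\mathcal{D}_A=(h^{(p)}_i)_{i\in A}$ in the space $X_A=\operatorname{span}\mathcal{D}_A\subset L_p[0,1]$ terminate in at most $K_p\,2^m m\ln m$ iterations for every initial vector in $X_A$ (that is, in at most $O(2^m m\ln m)$ iterations).
   Context: Haar functions on $[0,1]$: $h_0\equiv 1$, and for $n\ge 0$, $0\le k<2^n$, $i=2^n+k$, $h_i=1$ on $[k/2^n,(2k+1)/2^{n+1})$, $h_i=-1$ on $[(2k+1)/2^{n+1},(k+1)/2^n)$, and $h_i=0$ elsewhere. Normalized: $h_i^{(p)}=h_i/\|h_i\|_p$. The space $X_A$ carries the norm of $L_p[0,1]$ (real scalars). Greedy algorithms. Let $X$ be a smooth finite-dimensional real Banach space and $\mathcal{D}\subset X$ a finite set of norm-one vectors spanning $X$. For nonzero $y\in X$, $F_y\in X^*$ denotes its (unique) norming functional: $\|F_y\|=1$, $F_y(y)=\|y\|$. A greedy step applied to a nonzero $y\in X$ selects $\varphi(y)\in\mathcal{D}$ by a selection criterion and then selects $\lambda(y)\in\mathbb{R}$ minimizing $\|y-\lambda\varphi(y)\|$ over $\lambda\in\mathbb{R}$. - $X$-Greedy Algorithm (XGA): $\varphi(y)$ is any element of $\mathcal{D}$ with $\min_{\lambda\in\mathbb{R}}\|y-\lambda\varphi(y)\|=\min_{\lambda\in\mathbb{R},\,\varphi\in\mathcal{D}}\|y-\lambda\varphi\|$.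 - Dual Greedy Algorithm (DGA): $\varphi(y)$ is any element of $\mathcal{D}$ with $|F_y(\varphi(y))|=\max_{\varphi\in\mathcal{D}}|F_y(\varphi)|$. From an initial vector $x$ one sets $x_0=x$ and, as long as $x_{n-1}\ne 0$, $x_n=x_{n-1}-\lambda(x_{n-1})\varphi(x_{n-1})$. The algorithm terminates in at most $N$ iterations if $x_n=0$ for some $n\le N$, whatever admissible choices are made. *)

theory Defs
  imports
    "HOL-Analysis.Analysis"
    "HOL-Library.Function_Algebras"
    "HOL-Library.Discrete_Functions"
begin

instantiation "fun" :: (type, real_vector) real_vector
begin

definition scaleR_fun :: "real \<Rightarrow> ('a \<Rightarrow> 'b) \<Rightarrow> 'a \<Rightarrow> 'b"
  where "scaleR_fun c f = (\<lambda>t. c *\<^sub>R f t)"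

instance
  by standard (simp_all add: scaleR_fun_def fun_eq_iff scaleR_add_left scaleR_add_right)

end

text \<open>A positive index is uniquely \<open>i = 2^n + k\<close> with \<open>k < 2^n\<close>, namely with
  \<open>n = floor_log i\<close>; see \<open>haar_dyadic\<close> below. All functions are extended by 0 outside [0,1].\<close>

definition haar :: "nat \<Rightarrow> real \<Rightarrow> real" where
  "haar i =
    (if i = 0 then indicator {0..1}
     else let n = floor_log i; k = i - 2 ^ n in
       (\<lambda>t. if real k / 2 ^ n \<le> t \<and> t < (2 * real k + 1) / 2 ^ (n + 1) then 1
            else if (2 * real k + 1) / 2 ^ (n + 1) \<le> t \<and> t < (real k + 1) / 2 ^ n then - 1
            else 0))"

lemma haar_dyadic:
  assumes "k < 2 ^ n"
  shows "haar (2 ^ n + k) =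
    (\<lambda>t. if real k / 2 ^ n \<le> t \<and> t < (2 * real k + 1) / 2 ^ (n + 1) then 1
         else if (2 * real k + 1) / 2 ^ (n + 1) \<le> t \<and> t < (real k + 1) / 2 ^ n then - 1
         else 0)"
proof -
  have "floor_log (2 ^ n + k) = n"
    using assms by (intro floor_log_eqI) auto
  then show ?thesis
    by (simp add: haar_def)
qed

definition Lp_norm :: "real \<Rightarrow> (real \<Rightarrow> real) \<Rightarrow> real" where
  "Lp_norm p f = (set_lebesgue_integral lborel {0..1} (\<lambda>t. \<bar>f t\<bar> powr p)) powr (1 / p)"

definition haar_normalized :: "real \<Rightarrow> nat \<Rightarrow> real \<Rightarrow> real" where
  "haar_normalized p i = (1 / Lp_norm p (haar i)) *\<^sub>R haar i"

definition haar_dict :: "real \<Rightarrow> nat set \<Rightarrow> (real \<Rightarrow> real) set" where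
  "haar_dict p A = haar_normalized p ` A"

text \<open>Elements are functions rather than almost-everywhere classes. Nothing is lost: a linear
  combination of Haar functions that vanishes almost everywhere on [0,1] vanishes identically,
  so \<open>Lp_norm p\<close> is a norm on this space and its zero vector is the zero function.\<close>

definition haar_space :: "real \<Rightarrow> nat set \<Rightarrow> (real \<Rightarrow> real) set" where
  "haar_space p A = span (haar_dict p A)"

text \<open>The ambient space is a finite-dimensional subspace \<open>X\<close> of a real vector space, normed
  by \<open>N\<close>; the dictionary is a finite set \<open>D \<subseteq> X\<close> of vectors of norm one.\<close>

definition linear_functional_on :: "'a::real_vector set \<Rightarrow> ('a \<Rightarrow> real) \<Rightarrow> bool" where
  "linear_functional_on X F \<longleftrightarrow>
     (\<forall>x\<in>X. \<forall>y\<in>X. F (x + y) = F x + F y) \<and> (\<forall>c. \<forall>x\<in>X. F (c *\<^sub>R x) = c * F x)"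

definition dual_norm :: "'a::real_vector set \<Rightarrow> ('a \<Rightarrow> real) \<Rightarrow> ('a \<Rightarrow> real) \<Rightarrow> real" where
  "dual_norm X N F = (SUP x\<in>{x \<in> X. N x \<le> 1}. \<bar>F x\<bar>)"

definition norming_functional ::
  "'a::real_vector set \<Rightarrow> ('a \<Rightarrow> real) \<Rightarrow> 'a \<Rightarrow> ('a \<Rightarrow> real) \<Rightarrow> bool" where
  "norming_functional X N y F \<longleftrightarrow>
     linear_functional_on X F \<and> dual_norm X N F = 1 \<and> F y = N y"

definition xga_select ::
  "('a::real_vector \<Rightarrow> real) \<Rightarrow> 'a set \<Rightarrow> 'a \<Rightarrow> 'a \<Rightarrow> bool" where
  "xga_select N D y \<phi> \<longleftrightarrow> \<phi> \<in> D \<and>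
     (INF l. N (y - l *\<^sub>R \<phi>)) = (INF (l, \<psi>)\<in>UNIV \<times> D. N (y - l *\<^sub>R \<psi>))"

text \<open>In a smooth space the norming functional of \<open>y \<noteq> 0\<close> is unique on \<open>X\<close>; the existential
  quantifier refers to it without fixing its irrelevant values outside \<open>X\<close>.\<close>

definition dga_select ::
  "'a::real_vector set \<Rightarrow> ('a \<Rightarrow> real) \<Rightarrow> 'a set \<Rightarrow> 'a \<Rightarrow> 'a \<Rightarrow> bool" where
  "dga_select X N D y \<phi> \<longleftrightarrow> \<phi> \<in> D \<and>
     (\<exists>F. norming_functional X N y F \<and> \<bar>F \<phi>\<bar> = Max ((\<lambda>\<psi>. \<bar>F \<psi>\<bar>) ` D))"

definition greedy_step ::
  "('a \<Rightarrow> 'a \<Rightarrow> bool) \<Rightarrow> ('a::real_vector \<Rightarrow> real) \<Rightarrow> 'a \<Rightarrow> 'a \<Rightarrow> bool" where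
  "greedy_step select N y z \<longleftrightarrow>
     (\<exists>\<phi> l. select y \<phi> \<and> (\<forall>l'. N (y - l *\<^sub>R \<phi>) \<le> N (y - l' *\<^sub>R \<phi>)) \<and> z = y - l *\<^sub>R \<phi>)"

text \<open>The values of \<open>xs\<close> after the first zero are unconstrained and irrelevant.\<close>

definition greedy_run ::
  "('a \<Rightarrow> 'a \<Rightarrow> bool) \<Rightarrow> ('a::real_vector \<Rightarrow> real) \<Rightarrow> 'a \<Rightarrow> (nat \<Rightarrow> 'a) \<Rightarrow> bool" where
  "greedy_run select N x xs \<longleftrightarrow>
     xs 0 = x \<and>
     (\<forall>n. (\<forall>j\<le>n. xs j \<noteq> 0) \<longrightarrow> greedy_step select N (xs n) (xs (Suc n)))"

definition terminates_within ::
  "('a \<Rightarrow> 'a \<Rightarrow> bool) \<Rightarrow> ('a::real_vector \<Rightarrow> real) \<Rightarrow> 'a \<Rightarrow> real \<Rightarrow> bool" where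
  "terminates_within select N x B \<longleftrightarrow>
     (\<forall>xs. greedy_run select N x xs \<longrightarrow> (\<exists>n. real n \<le> B \<and> xs n = 0))"

end

theory Submission
  imports Defs
begin

text \<open>Since \<open>h\<^sub>j\<close> is constant on the support of \<open>h\<^sub>i\<close> for \<open>j < i\<close>, an optimal step along \<open>h\<^sub>i\<close> leaves
  a coefficient of size at most \<open>C \<Sum>\<^bsub>j>i\<^esub> \<bar>c\<^sub>j\<bar>\<close>, with \<open>C\<close> depending only on \<open>p\<close> and not on the coefficients
  of smaller index. So if the coefficients with large index are bounded by \<open>s\<close>, with weights growing
  like \<open>(C m)^d\<close>, they stay so forever, whatever steps are taken. As long as the norm exceeds
  \<open>s (C m)^m\<close> by a constant multiple of \<open>m\<close>, the vector is carried by the \<open>k\<close> remaining indices, and 2-smoothness of the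
  norm makes each step shrink it by a factor \<open>1 - c/k\<^sup>2\<close>.

  Let \<open>T(k)\<close> be the number of steps after which the norm has dropped to that level when \<open>k\<close> indices
  remain, and let \<open>w\<close> be the largest of them. Until \<open>w\<close> is selected its coefficient is constant.
  Treating \<open>\<bar>c\<^sub>w\<bar>\<close> as the new level, \<open>T(k-1)\<close> steps bring the norm down to \<open>\<bar>c\<^sub>w\<bar>\<close> times a factor of
  logarithm \<open>O(m ln m)\<close>, and \<open>O(k\<^sup>2 m ln m)\<close> further steps would bring it below \<open>\<bar>c\<^sub>w\<bar>\<close>, so \<open>w\<close>
  has been selected by then; \<open>T(k-1)\<close> more steps suffice. Hence \<open>T(k) \<le> 2 T(k-1) + O(k\<^sup>2 m ln m)\<close>,
  and level \<open>s = 0\<close> means termination.\<close>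

section \<open>Signed powers\<close>

text \<open>For \<open>q = p - 1\<close> this is the derivative of
  \<open>\<bar>x\<bar> powr p / p\<close>, the nonlinearity behind the norming functionals of
  \<open>L_p\<close>.\<close>

definition signed_powr :: "real \<Rightarrow> real \<Rightarrow> real" where
  "signed_powr q x = x * \<bar>x\<bar> powr (q - 1)"

lemma signed_powr_0 [simp]: "signed_powr q 0 = 0"
  by (simp add: signed_powr_def)

lemma signed_powr_minus [simp]: "signed_powr q (- x) = - signed_powr q x"
  by (simp add: signed_powr_def)

lemma abs_signed_powr: "\<bar>signed_powr q x\<bar> = \<bar>x\<bar> powr q"
  by (cases "x = 0") (auto simp: signed_powr_def abs_mult powr_mult_base)

lemma mult_signed_powr: "x * signed_powr q x = \<bar>x\<bar> powr (q + 1)"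
proof (cases "x = 0")
  case False
  then have "x * signed_powr q x = \<bar>x\<bar> * (\<bar>x\<bar> * \<bar>x\<bar> powr (q - 1))"
    by (simp add: signed_powr_def)
  also have "\<dots> = \<bar>x\<bar> powr (q + 1)"
    using False by (simp add: powr_mult_base add.commute)
  finally show ?thesis .
qed simp

lemma signed_powr_scale: "signed_powr q (c * x) = signed_powr q c * signed_powr q x"
  by (simp add: signed_powr_def abs_mult powr_mult)

lemma signed_powr_pos: "x \<ge> 0 \<Longrightarrow> signed_powr q x = x powr q"
  using abs_signed_powr[of q x] by (simp add: signed_powr_def)

lemma powr_diff_le:
  fixes a b q :: real
  assumes "0 \<le> b" "b \<le> a" "1 \<le> q"
  shows "a powr q - b powr q \<le> q * (a - b) * a powr (q - 1)"
proof -
  \<comment> \<open>The mean value theorem is applied on intervals away from 0; for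
    \<open>b = 0\<close> the bound reduces to \<open>1 \<le> q\<close>.\<close>
  consider "b = a" | "b = 0" "b < a" | "0 < b" "b < a"
    using assms by linarith
  then show ?thesis
  proof cases
    case 2
    have "a * a powr (q - 1) \<le> q * (a * a powr (q - 1))"
      using 2 assms mult_right_mono[of 1 q "a * a powr (q - 1)"] by simp
    then show ?thesis using 2 by (simp add: powr_mult_base mult.assoc)
  next
    case 3
    obtain z where z: "b < z" "z < a" "a powr q - b powr q = (a - b) * (q * z powr (q - 1))"
      using MVT2[of b a "\<lambda>x. x powr q" "\<lambda>x. q * x powr (q - 1)"] 3
      by (force intro!: derivative_eq_intros)
    have "z powr (q - 1) \<le> a powr (q - 1)"
      using z 3 assms by (intro powr_mono2) auto
    then have "(a - b) * (q * z powr (q - 1)) \<le> (a - b) * (q * a powr (q - 1))"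
      using 3 assms by (intro mult_left_mono) auto
    then show ?thesis using z(3) by (simp add: mult_ac)
  qed simp
qed

text \<open>The derivative has absolute value \<open>q * \<bar>x\<bar> powr (q - 1)\<close>.
  Arguments of equal sign reduce to \<open>powr_diff_le\<close> by oddness; for opposite signs the
  two absolute values add up, as do the distances to 0.\<close>

lemma signed_powr_lipschitz:
  assumes "1 \<le> q" "\<bar>x\<bar> \<le> B" "\<bar>y\<bar> \<le> B"
  shows "\<bar>signed_powr q x - signed_powr q y\<bar> \<le> q * \<bar>x - y\<bar> * B powr (q - 1)"
proof -
  have same: "\<bar>signed_powr q a - signed_powr q b\<bar> \<le> q * \<bar>a - b\<bar> * B powr (q - 1)"
    if "0 \<le> b" "b \<le> a" "a \<le> B" for a b
  proof -
    have "\<bar>signed_powr q a - signed_powr q b\<bar> = a powr q - b powr q"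
      using that assms by (simp add: signed_powr_pos powr_mono2)
    also have "\<dots> \<le> q * (a - b) * a powr (q - 1)"
      using that assms by (intro powr_diff_le) auto
    also have "\<dots> \<le> q * (a - b) * B powr (q - 1)"
      using that assms by (intro mult_left_mono powr_mono2) auto
    finally show ?thesis using that by simp
  qed
  have opp: "\<bar>signed_powr q a - signed_powr q (- b)\<bar> \<le> q * \<bar>a + b\<bar> * B powr (q - 1)"
    if "0 \<le> b" "0 \<le> a" "a \<le> B" "b \<le> B" for a b
  proof -
    have "signed_powr q a \<le> a * B powr (q - 1)" "signed_powr q b \<le> b * B powr (q - 1)"
      using that assms unfolding signed_powr_def by (auto intro!: mult_left_mono powr_mono2)
    moreover have "0 \<le> signed_powr q a" "0 \<le> signed_powr q b"
      using that by (auto simp: signed_powr_def)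
    ultimately have "\<bar>signed_powr q a - signed_powr q (- b)\<bar> \<le> (a + b) * B powr (q - 1)"
      by (simp add: distrib_right)
    also have "\<dots> \<le> q * ((a + b) * B powr (q - 1))"
      using that assms mult_right_mono[of 1 q "(a + b) * B powr (q - 1)"] by simp
    finally show ?thesis using that by (simp add: mult.assoc)
  qed
  consider "0 \<le> x" "0 \<le> y" "x \<le> y" | "0 \<le> x" "0 \<le> y" "y \<le> x" | "x \<le> 0" "0 \<le> y" | "0 \<le> x" "y \<le> 0"
    | "x \<le> 0" "y \<le> 0" "x \<le> y" | "x \<le> 0" "y \<le> 0" "y \<le> x"
    by linarith
  then show ?thesis
  proof cases
    case 1 then show ?thesis using same[of x y] assms by (simp add: abs_minus_commute)
  next
    case 2 then show ?thesis using same[of y x] assms by simp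
  next
    case 3 then show ?thesis using opp[of "- x" y] assms by (simp add: abs_minus_commute)
  next
    case 4 then show ?thesis using opp[of "- y" x] assms by simp
  next
    case 5 then show ?thesis using same[of "- y" "- x"] assms by (simp add: abs_minus_commute)
  next
    case 6 then show ?thesis using same[of "- x" "- y"] assms by (simp add: abs_minus_commute)
  qed
qed

text \<open>This will measure the jump between the two halves of the support of a Haar function,
  where a function takes the values \<open>a + v\<close> and \<open>a - v\<close>. For
  \<open>a \<ge> 0\<close> and \<open>a \<le> v\<close> the second term has the favourable sign;
  otherwise both powers are compared with the larger one.\<close>

lemma signed_powr_gap:
  assumes "1 \<le> q" "0 \<le> v"
  shows "v * (\<bar>a\<bar> + v) powr (q - 1) \<le> signed_powr q (a + v) - signed_powr q (a - v)"
proof -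
  have nonneg: "v * (a + v) powr (q - 1) \<le> signed_powr q (a + v) - signed_powr q (a - v)" if "a \<ge> 0" for a
  proof (cases "a \<le> v")
    case True
    have "signed_powr q (a - v) \<le> 0"
      using True by (simp add: signed_powr_def mult_nonpos_nonneg)
    moreover have "v * (a + v) powr (q - 1) \<le> (a + v) * (a + v) powr (q - 1)"
      using that by (intro mult_right_mono) auto
    ultimately show ?thesis using assms that by (simp add: signed_powr_def)
  next
    case False
    then have "(a - v) * (a - v) powr (q - 1) \<le> (a - v) * (a + v) powr (q - 1)"
      using assms by (intro mult_left_mono powr_mono2) auto
    moreover have "0 \<le> v * (a - v) powr (q - 1)" "0 \<le> v * (a + v) powr (q - 1)"
      using assms by auto
    ultimately have "v * (a + v) powr (q - 1) \<le> (a + v) * (a + v) powr (q - 1) - (a - v) * (a - v) powr (q - 1)"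
      unfolding distrib_right left_diff_distrib by linarith
    then show ?thesis using assms that False by (simp add: signed_powr_def)
  qed
  show ?thesis
  proof (cases "a \<ge> 0")
    case True then show ?thesis using nonneg[of a] by simp
  next
    case False
    have "signed_powr q (a - v) = - signed_powr q (v - a)" "signed_powr q (a + v) = - signed_powr q (- a - v)"
      using signed_powr_minus[of q "v - a"] signed_powr_minus[of q "- a - v"] by (simp_all add: add.commute)
    then show ?thesis using nonneg[of "- a"] False by (simp add: algebra_simps)
  qed
qed

text \<open>This is the tangent inequality at \<open>y\<close> for the convex function
  \<open>\<bar>x\<bar> powr p\<close>, because
  \<open>y * signed_powr (p - 1) y = \<bar>y\<bar> powr p\<close>. It follows from Young's
  inequality with exponents \<open>p\<close> and \<open>p / (p - 1)\<close>.\<close>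

lemma signed_powr_young:
  fixes p x y :: real
  assumes "1 < p"
  shows "p * (signed_powr (p - 1) y * x) \<le> \<bar>x\<bar> powr p + (p - 1) * \<bar>y\<bar> powr p"
proof -
  have "\<bar>x\<bar> * \<bar>y\<bar> powr (p - 1) \<le> \<bar>x\<bar> powr p / p + (\<bar>y\<bar> powr (p - 1)) powr (p / (p - 1)) / (p / (p - 1))"
    using assms by (intro Youngs_inequality) (auto simp: field_simps)
  also have "(\<bar>y\<bar> powr (p - 1)) powr (p / (p - 1)) = \<bar>y\<bar> powr p"
    using assms by (simp add: powr_powr)
  finally have "p * (\<bar>x\<bar> * \<bar>y\<bar> powr (p - 1)) \<le> p * (\<bar>x\<bar> powr p / p + \<bar>y\<bar> powr p / (p / (p - 1)))"
    using assms by (intro mult_left_mono) auto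
  also have "\<dots> = \<bar>x\<bar> powr p + (p - 1) * \<bar>y\<bar> powr p"
    using assms by (simp add: field_simps)
  finally have "p * \<bar>signed_powr (p - 1) y * x\<bar> \<le> \<bar>x\<bar> powr p + (p - 1) * \<bar>y\<bar> powr p"
    by (simp add: abs_mult abs_signed_powr mult.commute)
  moreover have "p * (signed_powr (p - 1) y * x) \<le> p * \<bar>signed_powr (p - 1) y * x\<bar>"
    using assms by (intro mult_left_mono) auto
  ultimately show ?thesis by linarith
qed

text \<open>The tangent at \<open>x - t\<close>, evaluated at \<open>x\<close>, gives a first-order
  bound with the slope taken at \<open>x - t\<close>; the Lipschitz estimate moves the slope to
  \<open>x\<close> at a quadratic cost.\<close>

lemma abs_powr_quadratic_bound:
  fixes p x t :: real
  assumes "2 \<le> p"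
  shows "\<bar>x - t\<bar> powr p
    \<le> \<bar>x\<bar> powr p - p * (signed_powr (p - 1) x * t) + p * (p - 1) * (t\<^sup>2 * (\<bar>x\<bar> + \<bar>t\<bar>) powr (p - 2))"
proof -
  let ?\<psi> = "signed_powr (p - 1)"
  have "p * (?\<psi> (x - t) * x) \<le> \<bar>x\<bar> powr p + (p - 1) * \<bar>x - t\<bar> powr p"
    using assms by (intro signed_powr_young) auto
  moreover have "\<bar>x - t\<bar> powr p = (x - t) * ?\<psi> (x - t)"
    by (simp add: mult_signed_powr)
  ultimately have "\<bar>x - t\<bar> powr p \<le> \<bar>x\<bar> powr p - p * (?\<psi> (x - t) * t)"
    by (simp add: algebra_simps)
  also have "\<dots> = \<bar>x\<bar> powr p - p * (?\<psi> x * t) + p * (t * (?\<psi> x - ?\<psi> (x - t)))"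
    by (simp add: algebra_simps)
  also have "t * (?\<psi> x - ?\<psi> (x - t)) \<le> \<bar>t\<bar> * \<bar>?\<psi> x - ?\<psi> (x - t)\<bar>"
    by (metis abs_ge_self abs_mult)
  also have "\<dots> \<le> \<bar>t\<bar> * ((p - 1) * \<bar>x - (x - t)\<bar> * (\<bar>x\<bar> + \<bar>t\<bar>) powr ((p - 1) - 1))"
    using assms by (intro mult_left_mono signed_powr_lipschitz) auto
  also have "\<dots> = (p - 1) * (t\<^sup>2 * (\<bar>x\<bar> + \<bar>t\<bar>) powr (p - 2))"
    by (simp add: power2_eq_square mult_ac)
  finally show ?thesis using assms by (simp add: mult_ac)
qed

text \<open>The factor \<open>R powr (q - 1)\<close> matches the one in \<open>signed_powr_gap\<close>, which is what makes
  the bound of the reset coefficient independent of the constant part of the function.\<close>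

lemma signed_powr_perturb:
  assumes "1 \<le> q" "0 < v" "v \<le> R" "\<bar>x\<bar> \<le> R" "0 < e"
  shows "\<bar>signed_powr q (x + g) - signed_powr q x\<bar>
    \<le> q * (R powr (q - 1) * ((1 + e) powr (q - 1) * e * v + (1 + 1 / e) powr (q - 1) * (\<bar>g\<bar> powr (q + 1) / (e * v powr q))))"
proof -
  have "\<bar>signed_powr q (x + g) - signed_powr q x\<bar> \<le> q * \<bar>x + g - x\<bar> * (R + \<bar>g\<bar>) powr (q - 1)"
    using assms by (intro signed_powr_lipschitz) auto
  also have "\<dots> = q * (\<bar>g\<bar> * (R + \<bar>g\<bar>) powr (q - 1))"
    by simp
  finally have 1: "\<bar>signed_powr q (x + g) - signed_powr q x\<bar> \<le> q * (\<bar>g\<bar> * (R + \<bar>g\<bar>) powr (q - 1))" .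
  have nn: "0 \<le> (1 + e) powr (q - 1) * e * v" "0 \<le> (1 + 1 / e) powr (q - 1) * (\<bar>g\<bar> powr (q + 1) / (e * v powr q))"
    using assms by auto
  have "\<bar>g\<bar> * (R + \<bar>g\<bar>) powr (q - 1)
    \<le> R powr (q - 1) * ((1 + e) powr (q - 1) * e * v + (1 + 1 / e) powr (q - 1) * (\<bar>g\<bar> powr (q + 1) / (e * v powr q)))"
  \<comment> \<open>A small \<open>g\<close> enlarges \<open>R\<close> by at most the factor
    \<open>1 + e\<close>. A large \<open>g\<close> controls both summands, since \<open>R\<close>
    and \<open>\<bar>g\<bar>\<close> are then bounded by multiples of
    \<open>R * \<bar>g\<bar> / v\<close>.\<close>
  proof (cases "\<bar>g\<bar> \<le> e * v")
    case True
    have "e * v \<le> e * R" using assms by simp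
    with True have "R + \<bar>g\<bar> \<le> R * (1 + e)"
      unfolding distrib_left mult.commute[of R] by simp
    then have "(R + \<bar>g\<bar>) powr (q - 1) \<le> R powr (q - 1) * (1 + e) powr (q - 1)"
      using assms by (subst powr_mult[symmetric]) (auto intro!: powr_mono2)
    then have "\<bar>g\<bar> * (R + \<bar>g\<bar>) powr (q - 1) \<le> (e * v) * (R powr (q - 1) * (1 + e) powr (q - 1))"
      using True assms by (intro mult_mono) auto
    also have "\<dots> = R powr (q - 1) * ((1 + e) powr (q - 1) * e * v)" by simp
    also have "\<dots> \<le> R powr (q - 1) * ((1 + e) powr (q - 1) * e * v + (1 + 1 / e) powr (q - 1) * (\<bar>g\<bar> powr (q + 1) / (e * v powr q)))"
      using nn by (intro mult_left_mono) auto
    finally show ?thesis .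
  next
    case False
    then have g: "0 < \<bar>g\<bar>" and ge: "1 \<le> \<bar>g\<bar> / (e * v)"
      using assms mult_pos_pos[of e v] by (auto simp: less_imp_le simp del: mult_pos_pos)
    have "1 \<le> (\<bar>g\<bar> / v) * (1 / e)" using ge by (simp add: mult.commute)
    moreover have "1 \<le> R / v" using assms by simp
    then have "1 * \<bar>g\<bar> \<le> (R / v) * \<bar>g\<bar>" by (intro mult_right_mono) auto
    moreover have "R * 1 \<le> R * ((\<bar>g\<bar> / v) * (1 / e))"
      using calculation assms by (intro mult_left_mono) auto
    ultimately have "R + \<bar>g\<bar> \<le> R * ((\<bar>g\<bar> / v) * (1 + 1 / e))"
      by (simp add: algebra_simps)
    then have "(R + \<bar>g\<bar>) powr (q - 1) \<le> (R * ((\<bar>g\<bar> / v) * (1 + 1 / e))) powr (q - 1)"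
      using assms by (intro powr_mono2) auto
    also have "\<dots> = R powr (q - 1) * ((\<bar>g\<bar> powr (q - 1) / v powr (q - 1)) * (1 + 1 / e) powr (q - 1))"
      using assms by (simp add: powr_mult powr_divide)
    finally have "\<bar>g\<bar> * (R + \<bar>g\<bar>) powr (q - 1)
      \<le> \<bar>g\<bar> * (R powr (q - 1) * ((\<bar>g\<bar> powr (q - 1) / v powr (q - 1)) * (1 + 1 / e) powr (q - 1)))"
      by (intro mult_left_mono) auto
    \<comment> \<open>The additional factor is at least 1 and raises the power of
      \<open>\<bar>g\<bar>\<close> to \<open>q + 1\<close>, which is \<open>p\<close> in the
      application and integrates to a norm of \<open>g\<close>.\<close>
    also have "\<dots> \<le> (\<bar>g\<bar> / (e * v)) * (\<bar>g\<bar> * (R powr (q - 1) * ((\<bar>g\<bar> powr (q - 1) / v powr (q - 1)) * (1 + 1 / e) powr (q - 1))))"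
      using mult_right_mono[OF ge, of "\<bar>g\<bar> * (R powr (q - 1) * ((\<bar>g\<bar> powr (q - 1) / v powr (q - 1)) * (1 + 1 / e) powr (q - 1)))"]
      by simp
    also have "\<dots> = R powr (q - 1) * ((1 + 1 / e) powr (q - 1) * ((\<bar>g\<bar> * (\<bar>g\<bar> * \<bar>g\<bar> powr (q - 1))) / (e * (v * v powr (q - 1)))))"
      by (simp add: mult_ac)
    also have "\<bar>g\<bar> * (\<bar>g\<bar> * \<bar>g\<bar> powr (q - 1)) = \<bar>g\<bar> powr (q + 1)"
      using g by (simp add: powr_mult_base add.commute)
    also have "v * v powr (q - 1) = v powr q"
      using assms by (simp add: powr_mult_base)
    also have "R powr (q - 1) * ((1 + 1 / e) powr (q - 1) * (\<bar>g\<bar> powr (q + 1) / (e * v powr q)))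
      \<le> R powr (q - 1) * ((1 + e) powr (q - 1) * e * v + (1 + 1 / e) powr (q - 1) * (\<bar>g\<bar> powr (q + 1) / (e * v powr q)))"
      using nn by (intro mult_left_mono) auto
    finally show ?thesis .
  qed
  then have "q * (\<bar>g\<bar> * (R + \<bar>g\<bar>) powr (q - 1)) \<le> q *
    (R powr (q - 1) * ((1 + e) powr (q - 1) * e * v + (1 + 1 / e) powr (q - 1) * (\<bar>g\<bar> powr (q + 1) / (e * v powr q))))"
    using assms by (intro mult_left_mono) auto
  with 1 show ?thesis by linarith
qed

section \<open>Bounded Borel functions in \<open>L\<^sub>p[0,1]\<close>\<close>

abbreviation unit_leb :: "real measure" where
  "unit_leb \<equiv> restrict_space lborel {0..1}"

text \<open>A class containing the Haar sums, closed under all operations used below, and integrable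
  because the unit interval has finite measure.\<close>

definition bounded_borel :: "(real \<Rightarrow> real) \<Rightarrow> bool" where
  "bounded_borel f \<longleftrightarrow> f \<in> borel_measurable borel \<and> (\<exists>B. \<forall>t. \<bar>f t\<bar> \<le> B)"

lemma bounded_borel_const [intro]: "bounded_borel (\<lambda>t. c)"
  by (auto simp: bounded_borel_def)

lemma bounded_borel_add [intro]:
  assumes "bounded_borel f" "bounded_borel g"
  shows "bounded_borel (\<lambda>t. f t + g t)"
proof -
  obtain B C where "\<forall>t. \<bar>f t\<bar> \<le> B" "\<forall>t. \<bar>g t\<bar> \<le> C"
    using assms by (auto simp: bounded_borel_def)
  then have "\<forall>t. \<bar>f t + g t\<bar> \<le> B + C" by (meson abs_triangle_ineq add_mono order_trans)
  then show ?thesis using assms by (auto simp: bounded_borel_def)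
qed

lemma bounded_borel_mult [intro]:
  assumes "bounded_borel f" "bounded_borel g"
  shows "bounded_borel (\<lambda>t. f t * g t)"
proof -
  obtain B C where "\<forall>t. \<bar>f t\<bar> \<le> B" "\<forall>t. \<bar>g t\<bar> \<le> C"
    using assms by (auto simp: bounded_borel_def)
  then have "\<forall>t. \<bar>f t * g t\<bar> \<le> B * C" by (simp add: abs_mult mult_mono')
  then show ?thesis using assms by (auto simp: bounded_borel_def)
qed

lemma bounded_borel_minus [intro]: "bounded_borel f \<Longrightarrow> bounded_borel (\<lambda>t. - f t)"
  using bounded_borel_mult[of "\<lambda>t. -1" f] by auto

lemma bounded_borel_diff [intro]: "bounded_borel f \<Longrightarrow> bounded_borel g \<Longrightarrow> bounded_borel (\<lambda>t. f t - g t)"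
  using bounded_borel_add[of f "\<lambda>t. - g t"] by auto

lemma bounded_borel_sum [intro]:
  "(\<And>i. i \<in> S \<Longrightarrow> bounded_borel (f i)) \<Longrightarrow> bounded_borel (\<lambda>t. \<Sum>i\<in>S. f i t)"
  by (induction S rule: infinite_finite_induct) auto

lemma bounded_borel_abs_powr [intro]:
  assumes "0 \<le> p" "bounded_borel f"
  shows "bounded_borel (\<lambda>t. \<bar>f t\<bar> powr p)"
proof -
  obtain B where "\<forall>t. \<bar>f t\<bar> \<le> B"
    using assms by (auto simp: bounded_borel_def)
  then have "\<forall>t. \<bar>\<bar>f t\<bar> powr p\<bar> \<le> B powr p" using assms by (simp add: powr_mono2)
  then show ?thesis using assms unfolding bounded_borel_def by (auto intro!: measurable_abs_powr)
qed

lemma bounded_borel_abs [intro]: "bounded_borel f \<Longrightarrow> bounded_borel (\<lambda>t. \<bar>f t\<bar>)"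
  by (auto simp: bounded_borel_def)

lemma bounded_borel_signed_powr [intro]:
  "1 \<le> q \<Longrightarrow> bounded_borel f \<Longrightarrow> bounded_borel (\<lambda>t. signed_powr q (f t))"
  unfolding signed_powr_def by (intro bounded_borel_mult bounded_borel_abs_powr) auto

lemmas bounded_borel_intros = bounded_borel_const bounded_borel_add bounded_borel_mult bounded_borel_minus
  bounded_borel_diff bounded_borel_sum bounded_borel_abs_powr bounded_borel_abs bounded_borel_signed_powr

lemma bounded_borel_integrable:
  assumes "bounded_borel f"
  shows "integrable unit_leb f"
proof -
  interpret finite_measure unit_leb
    by (rule finite_measureI) (simp add: emeasure_restrict_space space_restrict_space)
  obtain B where "\<forall>t. \<bar>f t\<bar> \<le> B" using assms by (auto simp: bounded_borel_def)
  then show ?thesis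
    using assms unfolding bounded_borel_def
    by (intro integrable_const_bound[of _ B]) (auto intro!: measurable_restrict_space1)
qed

lemma Lp_norm_eq: "Lp_norm p f = (\<integral>t. \<bar>f t\<bar> powr p \<partial>unit_leb) powr (1 / p)"
  by (simp add: Lp_norm_def set_lebesgue_integral_def integral_restrict_space)

lemma Lp_norm_nonneg: "0 \<le> Lp_norm p f"
  by (simp add: Lp_norm_def)

lemma Lp_norm_powr: "0 < p \<Longrightarrow> Lp_norm p f powr p = (\<integral>t. \<bar>f t\<bar> powr p \<partial>unit_leb)"
  by (simp add: Lp_norm_eq powr_powr integral_nonneg_AE)

lemma Lp_norm_le:
  assumes "0 < p" "0 \<le> B" "(\<integral>t. \<bar>f t\<bar> powr p \<partial>unit_leb) \<le> B powr p"
  shows "Lp_norm p f \<le> B"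
proof -
  have "Lp_norm p f \<le> (B powr p) powr (1 / p)"
    unfolding Lp_norm_eq using assms by (intro powr_mono2) (auto simp: integral_nonneg_AE)
  then show ?thesis using assms by (simp add: powr_powr)
qed

lemma Lp_norm_scale:
  assumes "0 < p"
  shows "Lp_norm p (\<lambda>t. c * f t) = \<bar>c\<bar> * Lp_norm p f"
  using assms by (simp add: Lp_norm_eq abs_mult powr_mult powr_powr integral_nonneg_AE)

text \<open>The duality map of \<open>L_p\<close>: divided by
  \<open>Lp_norm p y powr (p - 1)\<close>, it is the norming functional of a nonzero
  \<open>y\<close>.\<close>

definition lp_dual :: "real \<Rightarrow> (real \<Rightarrow> real) \<Rightarrow> (real \<Rightarrow> real) \<Rightarrow> real" where
  "lp_dual p y f = (\<integral>t. signed_powr (p - 1) (y t) * f t \<partial>unit_leb)"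

lemma lp_dual_self: "0 < p \<Longrightarrow> lp_dual p y y = Lp_norm p y powr p"
  by (simp add: lp_dual_def Lp_norm_powr mult_signed_powr mult.commute)

lemma lp_dual_scale_left: "lp_dual p (\<lambda>t. c * y t) f = signed_powr (p - 1) c * lp_dual p y f"
  by (simp add: lp_dual_def signed_powr_scale mult.assoc)

lemma lp_dual_scale_right: "lp_dual p y (\<lambda>t. c * f t) = c * lp_dual p y f"
  by (simp add: lp_dual_def mult.left_commute)

lemma lp_dual_sum:
  assumes "2 \<le> p" "bounded_borel y" "\<And>i. i \<in> S \<Longrightarrow> bounded_borel (f i)"
  shows "lp_dual p y (\<lambda>t. \<Sum>i\<in>S. c i * f i t) = (\<Sum>i\<in>S. c i * lp_dual p y (f i))"
proof -
  have "lp_dual p y (\<lambda>t. \<Sum>i\<in>S. c i * f i t)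
      = (\<integral>t. (\<Sum>i\<in>S. c i * (signed_powr (p - 1) (y t) * f i t)) \<partial>unit_leb)"
    by (simp add: lp_dual_def sum_distrib_left mult.left_commute)
  also have "\<dots> = (\<Sum>i\<in>S. \<integral>t. c i * (signed_powr (p - 1) (y t) * f i t) \<partial>unit_leb)"
    by (intro Bochner_Integration.integral_sum bounded_borel_integrable bounded_borel_intros) (use assms in auto)
  finally show ?thesis by (simp add: lp_dual_def)
qed

lemma lp_dual_young:
  assumes "2 \<le> p" "bounded_borel y" "bounded_borel f"
  shows "p * \<bar>lp_dual p y f\<bar> \<le> Lp_norm p f powr p + (p - 1) * Lp_norm p y powr p"
proof -
  have *: "p * lp_dual p y f \<le> Lp_norm p f powr p + (p - 1) * Lp_norm p y powr p"
    if "bounded_borel f" for f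
  proof -
    have "p * lp_dual p y f = (\<integral>t. p * (signed_powr (p - 1) (y t) * f t) \<partial>unit_leb)"
      by (simp add: lp_dual_def)
    also have "\<dots> \<le> (\<integral>t. \<bar>f t\<bar> powr p + (p - 1) * \<bar>y t\<bar> powr p \<partial>unit_leb)"
      by (intro integral_mono bounded_borel_integrable bounded_borel_intros signed_powr_young) (use assms that in auto)
    also have "\<dots> = Lp_norm p f powr p + (p - 1) * Lp_norm p y powr p"
      using assms that by (subst Bochner_Integration.integral_add) (auto intro!: bounded_borel_integrable simp: Lp_norm_powr)
    finally show ?thesis .
  qed
  have "lp_dual p y (\<lambda>t. - f t) = - lp_dual p y f" "Lp_norm p (\<lambda>t. - f t) = Lp_norm p f"
    by (simp_all add: lp_dual_def Lp_norm_def)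
  then show ?thesis
    using *[of f] *[of "\<lambda>t. - f t"] assms by (cases "0 \<le> lp_dual p y f") auto
qed

lemma Lp_norm_eq_0_AE:
  assumes "0 < p" "bounded_borel f" "Lp_norm p f = 0"
  shows "AE t in unit_leb. f t = 0"
proof -
  have "(\<integral>t. \<bar>f t\<bar> powr p \<partial>unit_leb) = 0"
    using Lp_norm_powr[of p f] assms by simp
  then have "AE t in unit_leb. \<bar>f t\<bar> powr p = 0"
    using assms by (subst (asm) integral_nonneg_eq_0_iff_AE) (auto intro!: bounded_borel_integrable)
  then show ?thesis by simp
qed

text \<open>By homogeneity both norms may be taken to be 1, and then \<open>lp_dual_young\<close>
  has right-hand side \<open>1 + (p - 1) = p\<close>. A function of norm 0 vanishes almost
  everywhere and is treated apart.\<close>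

lemma lp_dual_holder:
  assumes "2 \<le> p" "bounded_borel y" "bounded_borel f"
  shows "\<bar>lp_dual p y f\<bar> \<le> Lp_norm p y powr (p - 1) * Lp_norm p f"
proof -
  consider "Lp_norm p y = 0" | "Lp_norm p f = 0" | "0 < Lp_norm p y" "0 < Lp_norm p f"
    using Lp_norm_nonneg[of p y] Lp_norm_nonneg[of p f] by linarith
  then show ?thesis
  proof cases
    case 1
    then have "AE t in unit_leb. y t = 0" using assms by (intro Lp_norm_eq_0_AE) auto
    then have "lp_dual p y f = 0" unfolding lp_dual_def by (intro integral_eq_zero_AE) auto
    then show ?thesis using Lp_norm_nonneg[of p f] by simp
  next
    case 2
    then have "AE t in unit_leb. f t = 0" using assms by (intro Lp_norm_eq_0_AE) auto
    then have "lp_dual p y f = 0" unfolding lp_dual_def by (intro integral_eq_zero_AE) auto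
    then show ?thesis using Lp_norm_nonneg[of p f] by simp
  next
    case 3
    define u g where "u = (\<lambda>t. 1 / Lp_norm p y * y t)" and "g = (\<lambda>t. 1 / Lp_norm p f * f t)"
    have "Lp_norm p u = 1" "Lp_norm p g = 1"
      unfolding u_def g_def using 3 assms by (subst Lp_norm_scale; simp)+
    moreover have "bounded_borel u" "bounded_borel g"
      unfolding u_def g_def by (intro bounded_borel_intros assms)+
    ultimately have "p * \<bar>lp_dual p u g\<bar> \<le> p"
      using lp_dual_young[of p u g] assms by simp
    then have "\<bar>lp_dual p u g\<bar> \<le> 1" using assms by (auto simp: mult_le_cancel_left1)
    moreover have "lp_dual p u g = signed_powr (p - 1) (1 / Lp_norm p y) * (1 / Lp_norm p f * lp_dual p y f)"
      unfolding u_def g_def by (simp only: lp_dual_scale_left lp_dual_scale_right)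
    ultimately show ?thesis
      using 3 by (simp add: signed_powr_pos powr_divide abs_mult field_simps)
  qed
qed

section \<open>Second-order smoothness of the norm and optimal steps in one direction\<close>

lemma one_plus_le_powr:
  fixes p s :: real
  assumes "1 < p" "-1 \<le> s"
  shows "1 + s \<le> (1 + s / p) powr p"
proof -
  have "0 \<le> 1 + s / p" using assms by (simp add: field_simps)
  moreover have "p * (1 + s / p) \<le> \<bar>1 + s / p\<bar> powr p + (p - 1)"
    using signed_powr_young[of p 1 "1 + s / p"] assms by (simp add: signed_powr_def)
  ultimately show ?thesis using assms by (simp add: distrib_left)
qed

text \<open>The step is measured in units of \<open>Lp_norm p y\<close>, so all terms scale alike.
  Integrating \<open>abs_powr_quadratic_bound\<close> bounds the p-th power of the norm. The
  remainder is split by \<open>(u + v) powr p \<le> 2 powr p * (u powr p + v powr p)\<close>, and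
  its two parts have equal integrals, whence \<open>2 powr (p + 1)\<close>. Bernoulli's inequality
  then takes the p-th root.\<close>

lemma Lp_norm_diff_quadratic:
  assumes p: "2 \<le> p" and bb: "bounded_borel y" "bounded_borel f"
    and r: "0 < Lp_norm p y" and f1: "Lp_norm p f = 1" and mu: "\<bar>\<mu>\<bar> \<le> 1"
  shows "Lp_norm p (\<lambda>t. y t - Lp_norm p y * \<mu> * f t)
    \<le> Lp_norm p y * (1 - \<mu> * (lp_dual p y f / Lp_norm p y powr (p - 1)) + (p - 1) * 2 powr (p + 1) * \<mu>\<^sup>2)"
proof -
  define r where "r = Lp_norm p y"
  define F where "F = lp_dual p y f / r powr (p - 1)"
  define K where "K = (p - 1) * 2 powr (p + 1)"
  have r0: "0 < r" using r by (simp add: r_def)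
  have rp: "r powr p = r * r powr (p - 1)" using r0 by (simp add: powr_mult_base)
  have pt: "\<bar>y t - r * \<mu> * f t\<bar> powr p \<le> \<bar>y t\<bar> powr p - (p * r * \<mu>) * (signed_powr (p - 1) (y t) * f t)
      + (p * (p - 1) * \<mu>\<^sup>2 * 2 powr p) * (\<bar>y t\<bar> powr p + r powr p * \<bar>f t\<bar> powr p)" for t
  proof -
    let ?x = "\<bar>y t\<bar>" and ?b = "r * \<bar>f t\<bar>"
    have b0: "0 \<le> ?b" using r0 by simp
    have "(r * \<mu> * f t)\<^sup>2 * (?x + \<bar>r * \<mu> * f t\<bar>) powr (p - 2) \<le> (\<mu>\<^sup>2 * ?b\<^sup>2) * (?x + ?b) powr (p - 2)"
    proof -
      have "\<bar>\<mu>\<bar> * \<bar>f t\<bar> \<le> 1 * \<bar>f t\<bar>" using mu by (intro mult_right_mono) auto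
      then have "?x + \<bar>r * \<mu> * f t\<bar> \<le> ?x + ?b"
        using r0 by (simp add: abs_mult mult.assoc)
      then have "(?x + \<bar>r * \<mu> * f t\<bar>) powr (p - 2) \<le> (?x + ?b) powr (p - 2)"
        using p by (intro powr_mono2) auto
      moreover have "(r * \<mu> * f t)\<^sup>2 = \<mu>\<^sup>2 * ?b\<^sup>2"
        by (simp add: power_mult_distrib)
      ultimately show ?thesis by (simp add: mult_left_mono)
    qed
    also have "\<dots> \<le> (\<mu>\<^sup>2 * (?x + ?b)\<^sup>2) * (?x + ?b) powr (p - 2)"
      using b0 by (intro mult_right_mono mult_left_mono power_mono) auto
    also have "\<dots> = \<mu>\<^sup>2 * (?x + ?b) powr p"
    proof -
      have "0 \<le> ?x + ?b" using b0 by linarith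
      then have "(?x + ?b) * ((?x + ?b) * (?x + ?b) powr (p - 2)) = (?x + ?b) powr (1 + (1 + (p - 2)))"
        by (simp only: powr_mult_base)
      then show ?thesis by (simp only: power2_eq_square mult.assoc) simp
    qed
    also have "\<dots> \<le> \<mu>\<^sup>2 * (2 powr p * (?x powr p + r powr p * \<bar>f t\<bar> powr p))"
    proof (intro mult_left_mono)
      have "(?x + ?b) powr p \<le> (2 * max ?x ?b) powr p"
        using p b0 by (intro powr_mono2) auto
      also have "\<dots> = 2 powr p * (max ?x ?b) powr p" using b0 by (simp add: powr_mult)
      also have "(max ?x ?b) powr p \<le> ?x powr p + ?b powr p" by (simp add: max_def)
      also have "?b powr p = r powr p * \<bar>f t\<bar> powr p" using r0 by (simp add: powr_mult)
      finally show "(?x + ?b) powr p \<le> 2 powr p * (?x powr p + r powr p * \<bar>f t\<bar> powr p)" by simp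
    qed simp
    finally have "p * (p - 1) * ((r * \<mu> * f t)\<^sup>2 * (?x + \<bar>r * \<mu> * f t\<bar>) powr (p - 2))
        \<le> p * (p - 1) * (\<mu>\<^sup>2 * (2 powr p * (?x powr p + r powr p * \<bar>f t\<bar> powr p)))"
      using p by (intro mult_left_mono) auto
    then show ?thesis
      using abs_powr_quadratic_bound[OF p, of "y t" "r * \<mu> * f t"] by (simp add: mult_ac)
  qed
  have fint: "(\<integral>t. \<bar>f t\<bar> powr p \<partial>unit_leb) = 1" and yint: "(\<integral>t. \<bar>y t\<bar> powr p \<partial>unit_leb) = r powr p"
    using Lp_norm_powr[of p f] Lp_norm_powr[of p y] p f1 by (simp_all add: r_def)
  have "(\<integral>t. \<bar>y t - r * \<mu> * f t\<bar> powr p \<partial>unit_leb) \<le> (\<integral>t. \<bar>y t\<bar> powr p - (p * r * \<mu>) * (signed_powr (p - 1) (y t) * f t)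
      + (p * (p - 1) * \<mu>\<^sup>2 * 2 powr p) * (\<bar>y t\<bar> powr p + r powr p * \<bar>f t\<bar> powr p) \<partial>unit_leb)"
    by (intro integral_mono bounded_borel_integrable bounded_borel_intros pt) (use bb p in auto)
  also have "\<dots> = (\<integral>t. \<bar>y t\<bar> powr p \<partial>unit_leb) - (p * r * \<mu>) * lp_dual p y f
      + (p * (p - 1) * \<mu>\<^sup>2 * 2 powr p) * ((\<integral>t. \<bar>y t\<bar> powr p \<partial>unit_leb) + r powr p * (\<integral>t. \<bar>f t\<bar> powr p \<partial>unit_leb))"
  proof -
    have i: "integrable unit_leb (\<lambda>t. \<bar>y t\<bar> powr p)" "integrable unit_leb (\<lambda>t. \<bar>f t\<bar> powr p)"
      "integrable unit_leb (\<lambda>t. signed_powr (p - 1) (y t) * f t)"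
      by (intro bounded_borel_integrable bounded_borel_intros; use bb p in auto)+
    show ?thesis unfolding lp_dual_def using i by simp
  qed
  also have "\<dots> = r powr p - (p * r * \<mu>) * lp_dual p y f + (p * (p - 1) * \<mu>\<^sup>2 * 2 powr p) * (2 * r powr p)"
    by (simp add: fint yint)
  also have "\<dots> = r powr p * (1 + p * (K * \<mu>\<^sup>2 - \<mu> * F))"
  proof -
    have "r powr p * F = r * lp_dual p y f" using r0 by (simp add: F_def rp)
    moreover have "2 powr (p + 1) = 2 * 2 powr p" by (simp add: powr_add)
    moreover have "r powr p * (1 + p * (K * \<mu>\<^sup>2 - \<mu> * F)) = r powr p - p * \<mu> * (r powr p * F) + p * K * \<mu>\<^sup>2 * r powr p"
      by (simp add: algebra_simps)
    ultimately show ?thesis by (simp add: K_def mult_ac)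
  qed
  finally have I: "(\<integral>t. \<bar>y t - r * \<mu> * f t\<bar> powr p \<partial>unit_leb) \<le> r powr p * (1 + p * (K * \<mu>\<^sup>2 - \<mu> * F))" .
  moreover have "0 \<le> (\<integral>t. \<bar>y t - r * \<mu> * f t\<bar> powr p \<partial>unit_leb)" by (intro integral_nonneg_AE) auto
  ultimately have "0 \<le> r powr p * (1 + p * (K * \<mu>\<^sup>2 - \<mu> * F))" by linarith
  \<comment> \<open>Nonnegativity of the integral supplies the hypothesis of Bernoulli's inequality;
    since \<open>p \<ge> 1\<close> it also makes the base of the final power nonnegative.\<close>
  then have s: "-1 \<le> p * (K * \<mu>\<^sup>2 - \<mu> * F)" using r0 by (simp add: zero_le_mult_iff)
  have "-1 \<le> K * \<mu>\<^sup>2 - \<mu> * F"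
  proof (cases "K * \<mu>\<^sup>2 - \<mu> * F \<le> 0")
    case True
    then have "p * (K * \<mu>\<^sup>2 - \<mu> * F) \<le> 1 * (K * \<mu>\<^sup>2 - \<mu> * F)"
      using p by (intro mult_right_mono_neg) auto
    from order_trans[OF s this] show ?thesis by simp
  qed simp
  then have x0: "0 \<le> 1 + (K * \<mu>\<^sup>2 - \<mu> * F)" by simp
  have bern: "1 + p * (K * \<mu>\<^sup>2 - \<mu> * F) \<le> (1 + (K * \<mu>\<^sup>2 - \<mu> * F)) powr p"
    using one_plus_le_powr[of p, OF _ s] p by simp
  have "(\<integral>t. \<bar>y t - r * \<mu> * f t\<bar> powr p \<partial>unit_leb) \<le> r powr p * (1 + (K * \<mu>\<^sup>2 - \<mu> * F)) powr p"
    by (rule order_trans[OF I mult_left_mono[OF bern]]) simp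
  also have "\<dots> = (r * (1 + (K * \<mu>\<^sup>2 - \<mu> * F))) powr p" using r0 x0 by (simp add: powr_mult)
  finally have "Lp_norm p (\<lambda>t. y t - r * \<mu> * f t) \<le> r * (1 + (K * \<mu>\<^sup>2 - \<mu> * F))"
    using r0 x0 p by (intro Lp_norm_le) auto
  then show ?thesis by (simp add: r_def F_def K_def algebra_simps)
qed

text \<open>Near 0 a quadratic term cannot dominate a nonzero linear one. This replaces
  differentiation twice: for stationarity at a minimiser and for the uniqueness of norming
  functionals.\<close>

lemma linear_le_quadratic_imp_0:
  fixes d K :: real
  assumes "0 < K" "\<And>\<mu>. \<bar>\<mu>\<bar> \<le> 1 \<Longrightarrow> \<mu> * d \<le> K * \<mu>\<^sup>2"
  shows "d = 0"
proof (rule ccontr)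
  assume d: "d \<noteq> 0"
  define m where "m = min 1 (\<bar>d\<bar> / (2 * K))"
  have m: "0 < m" "m \<le> 1" "m * K \<le> \<bar>d\<bar> / 2"
    using d assms by (auto simp: m_def min_def field_simps)
  have "(sgn d * m) * d \<le> K * (sgn d * m)\<^sup>2"
    using d m by (intro assms) (auto simp: abs_mult abs_sgn_eq)
  also have "\<dots> = m * (m * K)" using d by (simp add: power2_eq_square sgn_if)
  also have "\<dots> \<le> m * (\<bar>d\<bar> / 2)" using m by (intro mult_left_mono) auto
  also have "(sgn d * m) * d = m * \<bar>d\<bar>" by (simp add: abs_sgn mult_ac)
  finally show False using m d by simp
qed

text \<open>Minimality bounds the left side of \<open>Lp_norm_diff_quadratic\<close> below by
  \<open>Lp_norm p z\<close>, so the linear term in \<open>\<mu>\<close> stays below the quadratic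
  one.\<close>

lemma lp_dual_eq_0_of_minimal:
  assumes p: "2 \<le> p" and bb: "bounded_borel z" "bounded_borel f" and f1: "Lp_norm p f = 1"
    and min: "\<And>s. Lp_norm p z \<le> Lp_norm p (\<lambda>t. z t - s * f t)"
  shows "lp_dual p z f = 0"
proof (cases "Lp_norm p z = 0")
  case True
  then show ?thesis using lp_dual_holder[OF p bb] by simp
next
  case False
  then have r: "0 < Lp_norm p z" using Lp_norm_nonneg[of p z] by linarith
  have "lp_dual p z f / Lp_norm p z powr (p - 1) = 0"
  proof (rule linear_le_quadratic_imp_0[of "(p - 1) * 2 powr (p + 1)"])
    fix \<mu> :: real assume "\<bar>\<mu>\<bar> \<le> 1"
    then have "Lp_norm p z * 1 \<le> Lp_norm p z * (1 - \<mu> * (lp_dual p z f / Lp_norm p z powr (p - 1)) + (p - 1) * 2 powr (p + 1) * \<mu>\<^sup>2)"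
      using Lp_norm_diff_quadratic[OF p bb r f1, of \<mu>] min[of "Lp_norm p z * \<mu>"] by simp
    then show "\<mu> * (lp_dual p z f / Lp_norm p z powr (p - 1)) \<le> (p - 1) * 2 powr (p + 1) * \<mu>\<^sup>2"
      using r by (simp only: mult_le_cancel_left_pos)
  qed (use p in simp)
  then show ?thesis using r by simp
qed

lemma Lp_norm_best_step:
  assumes p: "2 \<le> p" and bb: "bounded_borel y" "bounded_borel f"
    and r: "0 < Lp_norm p y" and f1: "Lp_norm p f = 1"
  shows "\<exists>s. Lp_norm p (\<lambda>t. y t - s * f t)
    \<le> Lp_norm p y * (1 - (lp_dual p y f / Lp_norm p y powr (p - 1))\<^sup>2 / (4 * ((p - 1) * 2 powr (p + 1))))"
proof -
  define F where "F = lp_dual p y f / Lp_norm p y powr (p - 1)"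
  define K where "K = (p - 1) * 2 powr (p + 1)"
  have "1 \<le> (p - 1) * 2 powr (p + 1)"
    using p mult_mono[of 1 "p - 1" 1 "2 powr (p + 1)"] by (simp add: ge_one_powr_ge_zero)
  then have K: "1 \<le> K" by (simp add: K_def)
  have "\<bar>F\<bar> \<le> 1"
    using lp_dual_holder[OF p bb] r f1 by (simp add: F_def divide_le_eq)
  \<comment> \<open>\<open>\<mu> = F / (2 * K)\<close> minimises the quadratic upper bound; it is
    admissible because \<open>\<bar>F\<bar> \<le> 1 \<le> K\<close>.\<close>
  then have "\<bar>F / (2 * K)\<bar> \<le> 1" using K by (simp add: abs_mult divide_le_eq)
  from Lp_norm_diff_quadratic[OF p bb r f1 this]
  have "Lp_norm p (\<lambda>t. y t - Lp_norm p y * (F / (2 * K)) * f t) \<le> Lp_norm p y * (1 - F / (2 * K) * F + K * (F / (2 * K))\<^sup>2)"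
    by (simp add: F_def K_def)
  also have "1 - F / (2 * K) * F + K * (F / (2 * K))\<^sup>2 = 1 - F\<^sup>2 / (4 * K)"
    using K by (simp add: power2_eq_square field_simps)
  finally show ?thesis unfolding F_def K_def by blast
qed

section \<open>Stationarity along a Haar function bounds its coefficient\<close>

definition reset_const :: "real \<Rightarrow> real" where
  "reset_const p = (let q = p - 1; e = 1 / (4 * q * 2 powr (q - 1)) in 4 * q * (1 + 1 / e) powr (q - 1) / e)"

lemma reset_const_pos: "2 \<le> p \<Longrightarrow> 0 < reset_const p"
  unfolding reset_const_def Let_def
  by (intro divide_pos_pos mult_pos_pos powr_gt_zero[THEN iffD2]) (auto simp: add_nonneg_eq_0_iff)

text \<open>If \<open>g\<close> were 0, \<open>signed_powr (p - 1) (z t) * h t\<close> would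
  integrate to at least half the gap of \<open>signed_powr_gap\<close> times the measure of the
  support. Stationarity makes the true integral 0, so the perturbation by \<open>g\<close> must
  compensate for this. Gap and perturbation share the factor \<open>T\<close> depending on
  \<open>a\<close>, which cancels.\<close>

lemma stationary_haar_coeff_le_pos:
  assumes p: "2 \<le> p" and bb: "bounded_borel z" "bounded_borel h" "bounded_borel g"
    and h: "\<And>t. h t \<in> {-1, 0, 1}" "(\<integral>t. h t \<partial>unit_leb) = 0"
    and z: "\<And>t. t \<in> {0..1} \<Longrightarrow> h t \<noteq> 0 \<Longrightarrow> z t = a + v * h t + g t"
    and stat: "lp_dual p z h = 0" and v: "0 < v"
  shows "v powr p * (\<integral>t. \<bar>h t\<bar> \<partial>unit_leb) \<le> reset_const p * Lp_norm p g powr p"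
proof -
  define q where "q = p - 1"
  \<comment> \<open>Chosen so that the part of the perturbation proportional to \<open>v\<close>
    costs at most \<open>T * v / 4\<close>, half of what the gap provides.\<close>
  define e where "e = 1 / (4 * q * 2 powr (q - 1))"
  define w where "w = (\<integral>t. \<bar>h t\<bar> \<partial>unit_leb)"
  define R where "R = \<bar>a\<bar> + v"
  have q: "1 \<le> q" using p by (simp add: q_def)
  have "1 \<le> 4 * q * 2 powr (q - 1)"
    using q mult_mono[of 1 "4 * q" 1 "2 powr (q - 1)"] by (simp add: ge_one_powr_ge_zero)
  then have e: "0 < e" "e \<le> 1" by (auto simp: e_def field_simps)
  define E2 where "E2 = (1 + 1 / e) powr (q - 1) / e"
  have E2: "0 \<le> E2" using e by (simp add: E2_def)
  have E1: "q * ((1 + e) powr (q - 1) * e) \<le> 1 / 4"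
  proof -
    have "(1 + e) powr (q - 1) \<le> 2 powr (q - 1)" using e q by (intro powr_mono2) auto
    then have "q * ((1 + e) powr (q - 1) * e) \<le> q * (2 powr (q - 1) * e)"
      using e q by (intro mult_left_mono mult_right_mono) auto
    also have "\<dots> = 1 / 4" using q by (simp add: e_def)
    finally show ?thesis .
  qed
  have R: "0 < R" "v \<le> R" using v by (auto simp: R_def)
  define T where "T = R powr (q - 1)"
  have T: "0 < T" using R by (simp add: T_def)
  let ?\<psi> = "signed_powr q"
  \<comment> \<open>The values on the two halves are \<open>m\<close> plus and minus half the gap;
    the contribution \<open>m * h t\<close> disappears because \<open>h\<close> has mean
    zero.\<close>
  define m where "m = (?\<psi> (a + v) + ?\<psi> (a - v)) / 2"
  have pt: "\<bar>h t\<bar> * (T * v / 2) + m * h t - T * (\<bar>h t\<bar> * (v / 4)) - T * (q * E2 / v powr q * \<bar>g t\<bar> powr p)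
      \<le> ?\<psi> (z t) * h t" if "t \<in> {0..1}" for t
  proof (cases "h t = 0")
    case True
    then show ?thesis using T q E2 by simp
  next
    case False
    then have h1: "h t = 1 \<or> h t = -1" using h(1)[of t] by auto
    have gap: "T * v \<le> ?\<psi> (a + v) - ?\<psi> (a - v)"
      using signed_powr_gap[OF q, of v a] v by (simp add: T_def R_def mult_ac)
    have "\<bar>a + v * h t\<bar> \<le> R" using h1 v by (auto simp: R_def)
    from signed_powr_perturb[OF q v R(2) this e(1), of "g t"]
    have "\<bar>?\<psi> (z t) - ?\<psi> (a + v * h t)\<bar> \<le>
       T * (q * ((1 + e) powr (q - 1) * e) * v + q * E2 / v powr q * \<bar>g t\<bar> powr p)"
      using z[OF that False] by (simp add: T_def E2_def q_def algebra_simps)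
    also have "\<dots> \<le> T * (1 / 4 * v + q * E2 / v powr q * \<bar>g t\<bar> powr p)"
      using T E1 v by (intro mult_left_mono add_right_mono mult_right_mono) auto
    finally have "\<bar>?\<psi> (z t) - ?\<psi> (a + v * h t)\<bar> \<le> T * (v / 4) + T * (q * E2 / v powr q * \<bar>g t\<bar> powr p)"
      by (simp add: distrib_left)
    moreover define D where "D = T * (q * E2 / v powr q * \<bar>g t\<bar> powr p)"
    ultimately have *: "\<bar>?\<psi> (z t) - ?\<psi> (a + v * h t)\<bar> \<le> T * v / 4 + D" by simp
    then have "\<bar>h t\<bar> * (T * v / 2) + m * h t - T * (\<bar>h t\<bar> * (v / 4)) - D \<le> ?\<psi> (z t) * h t"
      using h1
    proof (elim disjE)
      assume h1: "h t = 1"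
      show ?thesis using *[unfolded h1] gap unfolding h1 m_def by (simp add: abs_le_iff) argo
    next
      assume h1: "h t = -1"
      show ?thesis using *[unfolded h1] gap unfolding h1 m_def by (simp add: abs_le_iff) argo
    qed
    then show ?thesis by (simp only: D_def)
  qed
  have "(\<integral>t. \<bar>h t\<bar> * (T * v / 2) + m * h t - T * (\<bar>h t\<bar> * (v / 4)) - T * (q * E2 / v powr q * \<bar>g t\<bar> powr p) \<partial>unit_leb)
     \<le> (\<integral>t. ?\<psi> (z t) * h t \<partial>unit_leb)"
    by (intro integral_mono bounded_borel_integrable bounded_borel_intros pt)
      (use bb p q in \<open>auto simp: space_restrict_space\<close>)
  also have "\<dots> = 0" using stat by (simp add: lp_dual_def q_def)
  finally have "(\<integral>t. \<bar>h t\<bar> * (T * v / 2) + m * h t - T * (\<bar>h t\<bar> * (v / 4)) - T * (q * E2 / v powr q * \<bar>g t\<bar> powr p) \<partial>unit_leb) \<le> 0" .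
  moreover have "(\<integral>t. \<bar>h t\<bar> * (T * v / 2) + m * h t - T * (\<bar>h t\<bar> * (v / 4)) - T * (q * E2 / v powr q * \<bar>g t\<bar> powr p) \<partial>unit_leb)
    = w * (T * v / 2) + m * (\<integral>t. h t \<partial>unit_leb) - T * (w * (v / 4)) - T * (q * E2 / v powr q * Lp_norm p g powr p)"
  proof -
    have i: "integrable unit_leb (\<lambda>t. \<bar>h t\<bar>)" "integrable unit_leb h" "integrable unit_leb (\<lambda>t. \<bar>g t\<bar> powr p)"
      using bb p by (auto intro!: bounded_borel_integrable)
    show ?thesis using i p by (simp add: w_def Lp_norm_powr)
  qed
  ultimately have "T * (w * v / 4) \<le> T * (q * E2 / v powr q * Lp_norm p g powr p)"
    using h(2) by (simp add: algebra_simps)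
  then have "w * v / 4 \<le> q * E2 / v powr q * Lp_norm p g powr p"
    using T by (simp only: mult_le_cancel_left_pos)
  then have "w * (v * v powr q) \<le> 4 * q * E2 * Lp_norm p g powr p" using v by (simp add: field_simps)
  also have "v * v powr q = v powr p" using v by (simp add: q_def powr_mult_base)
  also have "4 * q * E2 = reset_const p" by (simp only: reset_const_def E2_def e_def q_def Let_def times_divide_eq_right)
  finally show ?thesis by (simp add: w_def mult.commute)
qed

lemma stationary_haar_coeff_le:
  assumes p: "2 \<le> p" and bb: "bounded_borel z" "bounded_borel h" "bounded_borel g"
    and h: "\<And>t. h t \<in> {-1, 0, 1}" "(\<integral>t. h t \<partial>unit_leb) = 0"
    and z: "\<And>t. t \<in> {0..1} \<Longrightarrow> h t \<noteq> 0 \<Longrightarrow> z t = a + v * h t + g t"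
    and stat: "lp_dual p z h = 0"
  shows "\<bar>v\<bar> powr p * (\<integral>t. \<bar>h t\<bar> \<partial>unit_leb) \<le> reset_const p * Lp_norm p g powr p"
proof -
  consider "v = 0" | "0 < v" | "v < 0" by linarith
  then show ?thesis
  proof cases
    case 1
    then show ?thesis using reset_const_pos[OF p] by simp
  next
    case 2
    then show ?thesis using stationary_haar_coeff_le_pos[OF assms] by simp
  next
    case 3
    \<comment> \<open>Negating \<open>z\<close>, \<open>a\<close>, \<open>v\<close> and
      \<open>g\<close> while keeping \<open>h\<close> reduces to a positive coefficient.\<close>
    have "(- v) powr p * (\<integral>t. \<bar>h t\<bar> \<partial>unit_leb) \<le> reset_const p * Lp_norm p (\<lambda>t. - g t) powr p"
    proof (rule stationary_haar_coeff_le_pos[OF p, of "\<lambda>t. - z t" h "\<lambda>t. - g t" "- a"])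
      show "lp_dual p (\<lambda>t. - z t) h = 0" using stat by (simp add: lp_dual_def)
    qed (use bb h z 3 in auto)
    then show ?thesis using 3 by (simp add: Lp_norm_def)
  qed
qed

section \<open>Haar sums\<close>

lemma haar_0: "haar 0 t = indicator {0..1} t"
  by (simp add: haar_def)

lemma haar_index_cases:
  fixes i :: nat
  obtains "i = 0" | n k where "k < 2 ^ n" "i = 2 ^ n + k"
proof (cases "i = 0")
  case False
  have "2 ^ floor_log i \<le> i" "i < 2 ^ Suc (floor_log i)"
    using False floor_log_exp2_le[of i] floor_log_exp2_gt[of i] by auto
  then have "i - 2 ^ floor_log i < 2 ^ floor_log i" "i = 2 ^ floor_log i + (i - 2 ^ floor_log i)"
    by auto
  then show ?thesis using that by blast
qed (use that in blast)

lemma haar_floor: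
  assumes "k < 2 ^ n"
  shows "haar (2 ^ n + k) t =
    (if \<lfloor>2 ^ (n + 1) * t\<rfloor> = 2 * int k then 1 else if \<lfloor>2 ^ (n + 1) * t\<rfloor> = 2 * int k + 1 then - 1 else 0)"
  unfolding haar_dyadic[OF assms] floor_eq_iff by (auto simp: field_simps)

lemma haar_dyadic_nonzero_iff:
  assumes "k < 2 ^ n"
  shows "haar (2 ^ n + k) t \<noteq> 0 \<longleftrightarrow> \<lfloor>2 ^ n * t\<rfloor> = int k"
  unfolding haar_dyadic[OF assms] floor_eq_iff by (auto simp: field_simps)

lemma haar_values: "haar i t \<in> {-1, 0, 1}"
  by (cases i rule: haar_index_cases) (auto simp: haar_0 indicator_def haar_floor)

lemma haar_dyadic_indicator:
  assumes "k < 2 ^ n"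
  shows "haar (2 ^ n + k) = (\<lambda>t. indicator {real k / 2 ^ n..<(2 * real k + 1) / 2 ^ (n + 1)} t
    - indicator {(2 * real k + 1) / 2 ^ (n + 1)..<(real k + 1) / 2 ^ n} t)"
  unfolding haar_dyadic[OF assms] by (auto simp: indicator_def fun_eq_iff)

lemma bounded_borel_haar [intro]: "bounded_borel (haar i)"
proof -
  have "haar i \<in> borel_measurable borel"
  proof (cases i rule: haar_index_cases)
    case 1
    then show ?thesis by (simp add: haar_def)
  next
    case 2
    then show ?thesis by (simp add: haar_dyadic_indicator)
  qed
  moreover have "\<bar>haar i t\<bar> \<le> 1" for t using haar_values[of i t] by auto
  ultimately show ?thesis by (auto simp: bounded_borel_def)
qed

text \<open>On equal levels the supports are disjoint, and the constant is 0. On a coarser level the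
  support of \<open>haar i\<close> lies within a dyadic interval on which \<open>haar j\<close> does
  not change. The restriction to \<open>{0..1}\<close> serves \<open>haar 0\<close>.\<close>

lemma haar_constant_on_support:
  assumes "j < i"
  shows "\<exists>e. \<forall>t\<in>{0..1}. haar i t \<noteq> 0 \<longrightarrow> haar j t = e"
proof (cases j rule: haar_index_cases)
  case 1
  then show ?thesis by (auto simp: haar_0 indicator_def)
next
  case (2 l q)
  obtain n k where i: "k < 2 ^ n" "i = 2 ^ n + k"
    using assms by (cases i rule: haar_index_cases) auto
  have "2 ^ l < (2::nat) ^ Suc n" using assms 2 i by simp
  then have "l < Suc n" by (rule power_less_imp_less_exp[rotated]) simp
  then consider "l = n" | "l < n" by linarith
  then show ?thesis
  proof cases
    case eq: 1
    have "haar j t = 0" if "haar i t \<noteq> 0" for t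
      using that haar_dyadic_nonzero_iff[OF i(1), of t] haar_dyadic_nonzero_iff[OF 2(1), of t] 2(2) i(2) eq assms
      by (cases "haar j t = 0") auto
    then show ?thesis by blast
  next
    case lt: 2
    \<comment> \<open>The half-intervals of \<open>haar j\<close> have level \<open>l + 1\<close>,
      so the index of the one containing \<open>t\<close> is the level-\<open>n\<close> index
      divided by \<open>2 ^ s\<close>, rounded down.\<close>
    define s where "s = n - (l + 1)"
    have n: "n = l + 1 + s" using lt by (simp add: s_def)
    have "\<lfloor>2 ^ (l + 1) * t\<rfloor> = int k div 2 ^ s" if "haar i t \<noteq> 0" for t
    proof -
      have "2 ^ (l + 1) * t = 2 ^ n * t / real_of_int (2 ^ s)" by (simp add: n power_add)
      then have "\<lfloor>2 ^ (l + 1) * t\<rfloor> = \<lfloor>2 ^ n * t\<rfloor> div 2 ^ s"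
        by (simp only: floor_divide_real_eq_div[of "2 ^ s"] zero_le_power zero_le_numeral)
      then show ?thesis using that haar_dyadic_nonzero_iff[OF i(1), of t] i(2) by simp
    qed
    then show ?thesis unfolding 2(2) haar_floor[OF 2(1)] by auto
  qed
qed

lemma integral_unit_leb_indicator:
  assumes "0 \<le> a" "a \<le> b" "b \<le> 1"
  shows "(\<integral>t. indicator {a..<b} t \<partial>unit_leb) = b - a"
proof -
  have "(\<integral>t. indicator {a..<b} t \<partial>unit_leb) = (\<integral>t. (indicator {0..1} t * indicator {a..<b} t :: real) \<partial>lborel)"
    by (subst integral_restrict_space) simp_all
  also have "(\<lambda>t. indicator {0..1} t * indicator {a..<b} t) = (indicator {a..<b} :: real \<Rightarrow> real)"
    using assms by (auto simp: indicator_def)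
  finally show ?thesis using assms by simp
qed

lemma haar_integrals:
  shows integral_haar: "0 < i \<Longrightarrow> (\<integral>t. haar i t \<partial>unit_leb) = 0"
    and integral_abs_haar_pos: "0 < (\<integral>t. \<bar>haar i t\<bar> \<partial>unit_leb)"
proof -
  have "(0 < i \<longrightarrow> (\<integral>t. haar i t \<partial>unit_leb) = 0) \<and> 0 < (\<integral>t. \<bar>haar i t\<bar> \<partial>unit_leb)"
  proof (cases i rule: haar_index_cases)
    case 1
    have "(\<integral>t. \<bar>haar 0 t\<bar> \<partial>unit_leb) = (\<integral>t. (indicator {0..1} t * indicator {0..1} t :: real) \<partial>(lborel :: real measure))"
      by (subst integral_restrict_space) (simp_all add: haar_0)
    also have "(\<lambda>t. indicator {0..1} t * indicator {0..1} t) = (indicator {0..1} :: real \<Rightarrow> real)"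
      by (auto simp: indicator_def)
    finally show ?thesis using 1 by simp
  next
    case (2 n k)
    define a b c where "a = real k / 2 ^ n" and "b = (2 * real k + 1) / 2 ^ (n + 1)" and "c = (real k + 1) / 2 ^ n"
    have h: "haar i = (\<lambda>t. indicator {a..<b} t - indicator {b..<c} t)"
      unfolding 2(2) a_def b_def c_def by (rule haar_dyadic_indicator[OF 2(1)])
    have "real (k + 1) \<le> real (2 ^ n)" using 2 by (subst of_nat_le_iff) simp
    then have abc: "0 \<le> a" "a < b" "b < c" "c \<le> 1" "b - a = c - b"
      by (auto simp: a_def b_def c_def field_simps)
    have I: "(\<integral>t. indicator {a..<b} t \<partial>unit_leb) = b - a" "(\<integral>t. indicator {b..<c} t \<partial>unit_leb) = c - b"
      by (rule integral_unit_leb_indicator; use abc in linarith)+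
    have i: "integrable unit_leb (indicator {a..<b} :: real \<Rightarrow> real)" "integrable unit_leb (indicator {b..<c} :: real \<Rightarrow> real)"
      by (intro bounded_borel_integrable; auto simp: bounded_borel_def indicator_def intro!: exI[of _ 1])+
    have "\<bar>haar i t\<bar> = indicator {a..<b} t + indicator {b..<c} t" for t
      by (auto simp: h indicator_def)
    then show ?thesis using I i abc by (simp add: h)
  qed
  then show "0 < i \<Longrightarrow> (\<integral>t. haar i t \<partial>unit_leb) = 0" "0 < (\<integral>t. \<bar>haar i t\<bar> \<partial>unit_leb)" by auto
qed

lemma Lp_norm_haar_powr: "0 < p \<Longrightarrow> Lp_norm p (haar i) powr p = (\<integral>t. \<bar>haar i t\<bar> \<partial>unit_leb)"
proof -
  assume p: "0 < p"
  have "\<bar>haar i t\<bar> powr p = \<bar>haar i t\<bar>" for t using haar_values[of i t] by auto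
  then show ?thesis using p by (simp add: Lp_norm_powr)
qed

lemma Lp_norm_haar_pos: "0 < p \<Longrightarrow> 0 < Lp_norm p (haar i)"
  using Lp_norm_haar_powr[of p i] integral_abs_haar_pos[of i] Lp_norm_nonneg[of p "haar i"]
  by (cases "Lp_norm p (haar i) = 0") auto

lemma haar_normalized_apply: "haar_normalized p i t = 1 / Lp_norm p (haar i) * haar i t"
  by (simp add: haar_normalized_def scaleR_fun_def)

lemma haar_normalized_eq: "haar_normalized p i = (\<lambda>t. 1 / Lp_norm p (haar i) * haar i t)"
  by (simp add: haar_normalized_apply fun_eq_iff)

lemma bounded_borel_haar_normalized [intro]: "bounded_borel (haar_normalized p i)"
  unfolding haar_normalized_eq by (intro bounded_borel_mult bounded_borel_const bounded_borel_haar)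

lemma Lp_norm_haar_normalized: "0 < p \<Longrightarrow> Lp_norm p (haar_normalized p i) = 1"
  unfolding haar_normalized_eq using Lp_norm_haar_pos[of p i] by (subst Lp_norm_scale) auto

text \<open>The function of larger index has mean zero, and the other one is constant on its
  support.\<close>

lemma integral_haar_mult:
  assumes "i \<noteq> j"
  shows "(\<integral>t. haar i t * haar j t \<partial>unit_leb) = 0"
proof -
  have *: "(\<integral>t. haar i t * haar j t \<partial>unit_leb) = 0" if less: "j < i" for i j
  proof -
    obtain e where e: "\<And>t. t \<in> {0..1} \<Longrightarrow> haar i t \<noteq> 0 \<Longrightarrow> haar j t = e"
      using haar_constant_on_support[OF less] by blast
    have "(\<integral>t. haar i t * haar j t \<partial>unit_leb) = (\<integral>t. haar i t * e \<partial>unit_leb)"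
      using e by (intro Bochner_Integration.integral_cong) (auto simp: space_restrict_space)
    then show ?thesis using that integral_haar[of i] by simp
  qed
  show ?thesis using assms *[of i j] *[of j i] by (cases "j < i") (auto simp: mult.commute)
qed

text \<open>Haar functions take only the values -1, 0 and 1, so their signed powers are multiples of
  themselves. The duality map at \<open>haar_normalized p i\<close> is therefore the biorthogonal
  functional, and Hoelder's inequality bounds it by the norm.\<close>

definition haar_coeff :: "real \<Rightarrow> nat \<Rightarrow> (real \<Rightarrow> real) \<Rightarrow> real" where
  "haar_coeff p i y = lp_dual p (haar_normalized p i) y"

lemma haar_coeff_haar_normalized:
  assumes "0 < p"
  shows "haar_coeff p i (haar_normalized p j) = (if i = j then 1 else 0)"
proof (cases "i = j")
  case True
  then show ?thesis using assms by (simp add: haar_coeff_def lp_dual_self Lp_norm_haar_normalized)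
next
  case False
  have "signed_powr (p - 1) (haar i t) = haar i t" for t
    using haar_values[of i t] by (auto simp: signed_powr_def)
  then have "lp_dual p (haar i) (haar j) = 0"
    using integral_haar_mult[OF False] by (simp add: lp_dual_def)
  then show ?thesis using False
    unfolding haar_coeff_def haar_normalized_eq by (simp only: lp_dual_scale_left lp_dual_scale_right) simp
qed

lemma abs_haar_coeff_le:
  assumes "2 \<le> p" "bounded_borel y"
  shows "\<bar>haar_coeff p i y\<bar> \<le> Lp_norm p y"
  unfolding haar_coeff_def
  using lp_dual_holder[OF assms(1) bounded_borel_haar_normalized assms(2), of p i] assms(1)
  by (simp add: Lp_norm_haar_normalized)

section \<open>Finite Haar sums: expansion, norm estimates, reset of a coefficient\<close>

definition haar_sum :: "real \<Rightarrow> nat set \<Rightarrow> (nat \<Rightarrow> real) \<Rightarrow> real \<Rightarrow> real" where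
  "haar_sum p A c = (\<lambda>t. \<Sum>i\<in>A. c i * haar_normalized p i t)"

lemma bounded_borel_haar_sum [intro]: "bounded_borel (haar_sum p A c)"
  unfolding haar_sum_def by (intro bounded_borel_intros bounded_borel_haar_normalized)

lemma haar_coeff_haar_sum:
  assumes "2 \<le> p" "finite A"
  shows "haar_coeff p i (haar_sum p A c) = (if i \<in> A then c i else 0)"
proof -
  have "haar_coeff p i (haar_sum p A c) = (\<Sum>j\<in>A. c j * haar_coeff p i (haar_normalized p j))"
    unfolding haar_coeff_def haar_sum_def using assms by (intro lp_dual_sum) auto
  then show ?thesis using assms by (simp add: haar_coeff_haar_normalized if_distrib cong: if_cong)
qed

lemma haar_sum_diff:
  assumes "finite A" "i \<in> A"
  shows "haar_sum p A c - s *\<^sub>R haar_normalized p i = haar_sum p A (c(i := c i - s))"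
proof
  fix t
  have "(\<Sum>j\<in>A. (c(i := c i - s)) j * haar_normalized p j t)
      = (\<Sum>j\<in>A. c j * haar_normalized p j t - (if j = i then s * haar_normalized p i t else 0))"
    by (intro sum.cong) (auto simp: algebra_simps)
  also have "\<dots> = (\<Sum>j\<in>A. c j * haar_normalized p j t) - s * haar_normalized p i t"
    using assms by (simp add: sum_subtractf)
  finally show "(haar_sum p A c - s *\<^sub>R haar_normalized p i) t = haar_sum p A (c(i := c i - s)) t"
    by (simp add: haar_sum_def scaleR_fun_def)
qed

lemma haar_sum_cong: "(\<And>i. i \<in> A \<Longrightarrow> c i = d i) \<Longrightarrow> haar_sum p A c = haar_sum p A d"
  unfolding haar_sum_def by (intro ext sum.cong) auto

lemma haar_sum_eq_sum:
  assumes "finite A"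
  shows "haar_sum p A c = (\<Sum>i\<in>A. c i *\<^sub>R haar_normalized p i)"
  using assms
proof (induction A rule: finite_induct)
  case (insert a A)
  then show ?case by (simp add: haar_sum_def fun_eq_iff scaleR_fun_def)
qed (simp add: haar_sum_def fun_eq_iff)

lemma haar_space_iff:
  assumes "finite A"
  shows "y \<in> haar_space p A \<longleftrightarrow> (\<exists>c. y = haar_sum p A c)"
proof
  assume "y \<in> haar_space p A"
  then show "\<exists>c. y = haar_sum p A c"
    unfolding haar_space_def
  proof (rule span_induct[of _ _ "\<lambda>y. \<exists>c. y = haar_sum p A c"])
    show "subspace {y. \<exists>c. y = haar_sum p A c}"
    proof (rule subspaceI, goal_cases)
      case 1
      have "0 = haar_sum p A (\<lambda>i. 0)" by (simp add: haar_sum_def fun_eq_iff)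
      then show ?case by blast
    next
      case (2 x y)
      then obtain c d where "x = haar_sum p A c" "y = haar_sum p A d" by blast
      then have "x + y = haar_sum p A (\<lambda>i. c i + d i)"
        by (simp add: haar_sum_def fun_eq_iff distrib_right sum.distrib)
      then show ?case by blast
    next
      case (3 a x)
      then obtain c where "x = haar_sum p A c" by blast
      then have "a *\<^sub>R x = haar_sum p A (\<lambda>i. a * c i)"
        by (simp add: haar_sum_def fun_eq_iff scaleR_fun_def sum_distrib_left mult.assoc)
      then show ?case by blast
    qed
  next
    fix x assume "x \<in> haar_dict p A"
    then obtain i where i: "i \<in> A" "x = haar_normalized p i" by (auto simp: haar_dict_def)
    have "haar_sum p A (\<lambda>j. if j = i then 1 else 0) t = (\<Sum>j\<in>A. if j = i then haar_normalized p i t else 0)" for t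
      unfolding haar_sum_def by (intro sum.cong) auto
    then have "x = haar_sum p A (\<lambda>j. if j = i then 1 else 0)"
      using i assms by (simp add: fun_eq_iff)
    then show "\<exists>c. x = haar_sum p A c" by blast
  qed
next
  assume "\<exists>c. y = haar_sum p A c"
  then obtain c where "y = haar_sum p A c" by blast
  then have "y = (\<Sum>i\<in>A. c i *\<^sub>R haar_normalized p i)" by (simp add: haar_sum_eq_sum assms)
  also have "\<dots> \<in> haar_space p A"
    unfolding haar_space_def by (intro span_sum span_scale span_base) (simp add: haar_dict_def)
  finally show "y \<in> haar_space p A" .
qed

lemma haar_expansion:
  assumes "2 \<le> p" "finite A" "y \<in> haar_space p A"
  shows "y = haar_sum p A (\<lambda>i. haar_coeff p i y)"
proof -
  obtain c where c: "y = haar_sum p A c" using assms haar_space_iff by blast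
  show ?thesis
    by (subst c, rule haar_sum_cong) (simp add: c haar_coeff_haar_sum assms)
qed

lemma lp_dual_haar_sum:
  assumes "2 \<le> p" "bounded_borel y"
  shows "lp_dual p y (haar_sum p A c) = (\<Sum>i\<in>A. c i * lp_dual p y (haar_normalized p i))"
  unfolding haar_sum_def using assms by (intro lp_dual_sum) auto

text \<open>The triangle inequality via duality: pairing the sum \<open>y\<close> with its own image
  under the duality map gives \<open>Lp_norm p y powr p\<close>, and Hoelder bounds each summand by
  \<open>\<bar>c i\<bar> * Lp_norm p y powr (p - 1)\<close>.\<close>

lemma Lp_norm_haar_sum_le:
  assumes "2 \<le> p"
  shows "Lp_norm p (haar_sum p A c) \<le> (\<Sum>i\<in>A. \<bar>c i\<bar>)"
proof (cases "Lp_norm p (haar_sum p A c) = 0")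
  case True
  then show ?thesis by (simp add: sum_nonneg)
next
  case False
  define r where "r = Lp_norm p (haar_sum p A c)"
  have r: "0 < r" using False Lp_norm_nonneg[of p "haar_sum p A c"] by (simp add: r_def)
  have "r powr (p - 1) * r = lp_dual p (haar_sum p A c) (haar_sum p A c)"
    using assms r by (simp add: lp_dual_self r_def powr_mult_base mult.commute)
  also have "\<dots> = (\<Sum>i\<in>A. c i * lp_dual p (haar_sum p A c) (haar_normalized p i))"
    using assms by (intro lp_dual_haar_sum) auto
  also have "\<dots> \<le> (\<Sum>i\<in>A. \<bar>c i\<bar> * r powr (p - 1))"
  proof (rule sum_mono)
    fix i
    have "\<bar>lp_dual p (haar_sum p A c) (haar_normalized p i)\<bar> \<le> r powr (p - 1)"
      using lp_dual_holder[of p "haar_sum p A c" "haar_normalized p i"] assms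
      by (auto simp: r_def Lp_norm_haar_normalized)
    then have "\<bar>c i * lp_dual p (haar_sum p A c) (haar_normalized p i)\<bar> \<le> \<bar>c i\<bar> * r powr (p - 1)"
      by (simp add: abs_mult mult_left_mono)
    then show "c i * lp_dual p (haar_sum p A c) (haar_normalized p i) \<le> \<bar>c i\<bar> * r powr (p - 1)" by linarith
  qed
  also have "\<dots> = r powr (p - 1) * (\<Sum>i\<in>A. \<bar>c i\<bar>)" by (simp add: sum_distrib_left mult.commute)
  finally show ?thesis using r by (simp add: r_def)
qed

text \<open>On the support of \<open>haar i\<close> the smaller indices only contribute a constant,
  to which \<open>stationary_haar_coeff_le\<close> is insensitive. What remains on the right is the
  norm of the part with larger indices.\<close>

lemma haar_coeff_reset:
  assumes p: "2 \<le> p" and A: "finite A" "i \<in> A"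
    and min: "\<And>s. Lp_norm p (haar_sum p A c) \<le> Lp_norm p (haar_sum p A c - s *\<^sub>R haar_normalized p i)"
  shows "\<bar>c i\<bar> \<le> max 1 (reset_const p powr (1 / p)) * (\<Sum>j\<in>{j\<in>A. i < j}. \<bar>c j\<bar>)"
proof (cases "i = 0")
  case True
  \<comment> \<open>\<open>haar 0\<close> has nonzero mean, so the stationarity argument does not
    cover it. Here comparison with removing the coefficient altogether suffices, and the
    \<open>max 1\<close> in the factor accommodates this case.\<close>
  have "\<bar>c i\<bar> \<le> Lp_norm p (haar_sum p A c)"
    using abs_haar_coeff_le[of p "haar_sum p A c" i] haar_coeff_haar_sum[OF p A(1), of i c] p A by auto
  also have "\<dots> \<le> Lp_norm p (haar_sum p A (c(i := 0)))"
    using min[of "c i"] haar_sum_diff[OF A, of p c "c i"] by simp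
  also have "\<dots> \<le> (\<Sum>j\<in>A. \<bar>(c(i := 0)) j\<bar>)" by (rule Lp_norm_haar_sum_le[OF p])
  also have "\<dots> = (\<Sum>j\<in>{j\<in>A. i < j}. \<bar>c j\<bar>)"
    using A True by (intro sum.mono_neutral_cong_right) auto
  also have "1 * (\<Sum>j\<in>{j\<in>A. i < j}. \<bar>c j\<bar>) \<le> max 1 (reset_const p powr (1 / p)) * (\<Sum>j\<in>{j\<in>A. i < j}. \<bar>c j\<bar>)"
    by (intro mult_right_mono sum_nonneg) auto
  finally show ?thesis by simp
next
  case False
  define z where "z = haar_sum p A c"
  define N where "N = Lp_norm p (haar i)"
  define g where "g = haar_sum p {j\<in>A. i < j} c"
  have N: "0 < N" using Lp_norm_haar_pos p by (simp add: N_def)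
  have "\<forall>j\<in>{..<i}. \<exists>e. \<forall>t\<in>{0..1}. haar i t \<noteq> 0 \<longrightarrow> haar j t = e"
    using haar_constant_on_support by auto
  from bchoice[OF this] obtain e where
    "\<forall>j\<in>{..<i}. \<forall>t\<in>{0..1}. haar i t \<noteq> 0 \<longrightarrow> haar j t = e j" ..
  then have e: "haar j t = e j" if "j < i" "t \<in> {0..1}" "haar i t \<noteq> 0" for j t
    using that by auto
  \<comment> \<open>The constant value, on the support of \<open>haar i\<close>, of the part with
    smaller indices.\<close>
  define a where "a = (\<Sum>j\<in>{j\<in>A. j < i}. c j * (1 / Lp_norm p (haar j) * e j))"
  have zt: "z t = a + c i / N * haar i t + g t" if t: "t \<in> {0..1}" "haar i t \<noteq> 0" for t
  proof -
    have "A = {j\<in>A. j < i} \<union> ({i} \<union> {j\<in>A. i < j})" using A by auto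
    then have "z t = (\<Sum>j\<in>{j\<in>A. j < i} \<union> ({i} \<union> {j\<in>A. i < j}). c j * haar_normalized p j t)"
      by (simp add: z_def haar_sum_def)
    also have "\<dots> = (\<Sum>j\<in>{j\<in>A. j < i}. c j * haar_normalized p j t) + (c i * haar_normalized p i t + g t)"
      using A by (subst sum.union_disjoint) (auto simp: g_def haar_sum_def)
    also have "(\<Sum>j\<in>{j\<in>A. j < i}. c j * haar_normalized p j t) = a"
      unfolding a_def using e t by (intro sum.cong) (auto simp: haar_normalized_apply)
    finally show ?thesis by (simp add: haar_normalized_apply N_def)
  qed
  have "lp_dual p z (haar_normalized p i) = 0"
  proof (rule lp_dual_eq_0_of_minimal[OF p])
    fix s show "Lp_norm p z \<le> Lp_norm p (\<lambda>t. z t - s * haar_normalized p i t)"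
      using min[of s] by (simp add: z_def scaleR_fun_def fun_diff_def)
  qed (use p in \<open>auto simp: z_def Lp_norm_haar_normalized\<close>)
  then have "lp_dual p z (haar i) = 0"
    unfolding haar_normalized_eq lp_dual_scale_right using N by (simp add: N_def)
  then have "\<bar>c i / N\<bar> powr p * (\<integral>t. \<bar>haar i t\<bar> \<partial>unit_leb) \<le> reset_const p * Lp_norm p g powr p"
    using haar_values integral_haar False zt p
    by (intro stationary_haar_coeff_le[where z = z and a = a]) (auto simp: z_def g_def)
  also have "(\<integral>t. \<bar>haar i t\<bar> \<partial>unit_leb) = N powr p" using p by (simp add: N_def Lp_norm_haar_powr)
  also have "\<bar>c i / N\<bar> powr p * N powr p = \<bar>c i\<bar> powr p"
    using N by (simp add: powr_divide)
  finally have "(\<bar>c i\<bar> powr p) powr (1 / p) \<le> (reset_const p * Lp_norm p g powr p) powr (1 / p)"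
    using p by (intro powr_mono2) auto
  then have "\<bar>c i\<bar> \<le> reset_const p powr (1 / p) * Lp_norm p g"
    using p reset_const_pos[OF p] Lp_norm_nonneg[of p g] by (simp add: powr_powr powr_mult)
  also have "\<dots> \<le> max 1 (reset_const p powr (1 / p)) * (\<Sum>j\<in>{j\<in>A. i < j}. \<bar>c j\<bar>)"
    using Lp_norm_haar_sum_le[OF p, of "{j\<in>A. i < j}" c] Lp_norm_nonneg[of p g]
    by (intro mult_mono) (auto simp: g_def)
  finally show ?thesis .
qed

section \<open>Settling\<close>

text \<open>The exponent counts the larger indices of \<open>A\<close>, so weights grow towards
  small indices. Each index gains a factor \<open>L\<close>, later \<open>C * card A\<close>, to
  absorb a reset bounded by the sum over the larger ones.\<close>

definition settled :: "nat set \<Rightarrow> real \<Rightarrow> (nat \<Rightarrow> real) \<Rightarrow> real \<Rightarrow> nat set \<Rightarrow> bool" where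
  "settled A L c s U \<longleftrightarrow> (\<forall>i\<in>U. \<bar>c i\<bar> \<le> s * L ^ card {j\<in>A. i < j})"

lemma settled_sum:
  assumes "finite A" "U \<subseteq> A" "settled A L c s U" "1 \<le> L" "0 \<le> s"
  shows "(\<Sum>i\<in>U. \<bar>c i\<bar>) \<le> s * (real (card A) * L ^ card A)"
proof -
  have "(\<Sum>i\<in>U. \<bar>c i\<bar>) \<le> (\<Sum>i\<in>U. s * L ^ card A)"
  proof (rule sum_mono)
    fix i assume "i \<in> U"
    then have "\<bar>c i\<bar> \<le> s * L ^ card {j\<in>A. i < j}"
      using assms by (auto simp: settled_def)
    also have "\<dots> \<le> s * L ^ card A"
      using assms by (intro mult_left_mono power_increasing card_mono) auto
    finally show "\<bar>c i\<bar> \<le> s * L ^ card A" .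
  qed
  also have "\<dots> = real (card U) * (s * L ^ card A)" by simp
  also have "\<dots> \<le> real (card A) * (s * L ^ card A)"
    using assms by (intro mult_right_mono) (auto intro!: card_mono)
  finally show ?thesis by (simp add: mult_ac)
qed

text \<open>The at most \<open>card A\<close> summands have weight exponent at most
  \<open>card {j\<in>A. i < j} - 1\<close>, and the factor \<open>C * card A\<close> raises it by
  one. With no larger index the sum is empty, which avoids the truncated subtraction.\<close>

lemma settled_reset:
  assumes "finite A" "i \<in> A" "settled A (C * real (card A)) c s {j\<in>A. i < j}" "1 \<le> C" "0 \<le> s"
  shows "C * (\<Sum>j\<in>{j\<in>A. i < j}. \<bar>c j\<bar>) \<le> s * (C * real (card A)) ^ card {j\<in>A. i < j}"
proof -
  let ?V = "{j\<in>A. i < j}" and ?L = "C * real (card A)"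
  have "card A > 0" using assms by (auto simp: card_gt_0_iff)
  then have L1: "1 \<le> ?L"
    using assms mult_mono[of 1 C 1 "real (card A)"] by simp
  show ?thesis
  proof (cases "?V = {}")
    case True
    show ?thesis unfolding True using assms by simp
  next
    case False
    then have V: "card ?V > 0" using assms by (simp add: card_gt_0_iff)
    have "(\<Sum>j\<in>?V. \<bar>c j\<bar>) \<le> (\<Sum>j\<in>?V. s * ?L ^ (card ?V - 1))"
    proof (rule sum_mono)
      fix j assume j: "j \<in> ?V"
      have "{k\<in>A. j < k} \<subseteq> ?V - {j}" using j by auto
      then have "card {k\<in>A. j < k} \<le> card ?V - 1"
        using card_mono[of "?V - {j}" "{k\<in>A. j < k}"] j assms by simp
      then have "s * ?L ^ card {k\<in>A. j < k} \<le> s * ?L ^ (card ?V - 1)"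
        using assms L1 by (intro mult_left_mono power_increasing) auto
      then show "\<bar>c j\<bar> \<le> s * ?L ^ (card ?V - 1)"
        using assms j unfolding settled_def by (meson order_trans)
    qed
    also have "\<dots> = real (card ?V) * (s * ?L ^ (card ?V - 1))" by simp
    also have "\<dots> \<le> real (card A) * (s * ?L ^ (card ?V - 1))"
      using assms L1 by (intro mult_right_mono) (auto intro!: card_mono)
    finally have "C * (\<Sum>j\<in>?V. \<bar>c j\<bar>) \<le> C * (real (card A) * (s * ?L ^ (card ?V - 1)))"
      using assms by (intro mult_left_mono) auto
    also have "\<dots> = s * ?L ^ Suc (card ?V - 1)" by simp
    finally show ?thesis using V by simp
  qed
qed

primrec settle_time :: "(nat \<Rightarrow> nat) \<Rightarrow> nat \<Rightarrow> nat" where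
  "settle_time P 0 = 0"
| "settle_time P (Suc k) = 2 * settle_time P k + P (Suc k)"

text \<open>Abstracted from the greedy algorithms: \<open>c n\<close> are the coefficients and
  \<open>r n\<close> the norm after \<open>n\<close> steps. \<open>U\<close> holds the settled
  indices, closed upwards in \<open>A\<close>, and \<open>k\<close> counts the others. The factor 2
  in \<open>Q\<close> ensures that \<open>r n > Q * s\<close> leaves at most half of the norm to
  \<open>U\<close>, as \<open>decr\<close> demands.\<close>

lemma settling:
  fixes c :: "nat \<Rightarrow> nat \<Rightarrow> real" and r :: "nat \<Rightarrow> real" and C L Q :: real
  assumes L_def: "L = C * real (card A)"
    and Q_def: "Q = 2 * (real (card A) * L ^ card A)"
  assumes A: "finite A" and C: "1 \<le> C"
    and coeff: "\<And>n i. i \<in> A \<Longrightarrow> \<bar>c n i\<bar> \<le> r n"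
    and norm: "\<And>n. r n \<le> (\<Sum>i\<in>A. \<bar>c n i\<bar>)"
    and step: "\<And>n. \<exists>i\<in>A. (\<forall>j\<in>A. j \<noteq> i \<longrightarrow> c (Suc n) j = c n j) \<and>
                 \<bar>c (Suc n) i\<bar> \<le> C * (\<Sum>j\<in>{j\<in>A. i < j}. \<bar>c n j\<bar>)"
    and decr: "\<And>n W. W \<subseteq> A \<Longrightarrow> W \<noteq> {} \<Longrightarrow> 2 * (\<Sum>i\<in>A - W. \<bar>c n i\<bar>) \<le> r n \<Longrightarrow> r (Suc n) \<le> \<rho> (card W) * r n"
    and rho: "\<And>k. 0 \<le> \<rho> k" "\<And>k. 1 \<le> k \<Longrightarrow> \<rho> k ^ P k * Q < 1"
  shows "U \<subseteq> A \<Longrightarrow> (\<forall>i\<in>U. \<forall>j\<in>A. i < j \<longrightarrow> j \<in> U) \<Longrightarrow> card (A - U) = k \<Longrightarrow> 0 \<le> s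
    \<Longrightarrow> settled A L (c n) s U \<Longrightarrow> \<exists>n'\<ge>n. n' \<le> n + settle_time P k \<and> r n' \<le> Q * s"
proof (induction k arbitrary: U s n)
  case 0
  then have U: "U = A" using A by auto
  have L: "A \<noteq> {} \<Longrightarrow> 1 \<le> L"
    using A C mult_mono[of 1 C 1 "real (card A)"] unfolding L_def by (simp add: Suc_le_eq card_gt_0_iff)
  have "(\<Sum>i\<in>A. \<bar>c n i\<bar>) \<le> s * (real (card A) * L ^ card A)"
    using settled_sum[OF A, of A L "c n" s] 0 U L by (cases "A = {}") auto
  then have "r n \<le> s * (real (card A) * L ^ card A)"
    using norm[of n] by linarith
  also have "\<dots> \<le> Q * s"
  proof (cases "A = {}")
    case False
    then have "0 \<le> s * (real (card A) * L ^ card A)" using L 0 by auto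
    then show ?thesis unfolding Q_def by (simp add: mult_ac)
  qed (simp add: Q_def)
  finally show ?case by auto
next
  case (Suc k)
  have "A - U \<noteq> {}" using Suc.prems(3) by (metis card.empty nat.distinct(1))
  then have "A \<noteq> {}" by auto
  then have cA: "1 \<le> real (card A)" using A by (simp add: Suc_le_eq card_gt_0_iff)
  then have L: "1 \<le> L"
    using C mult_mono[of 1 C 1 "real (card A)"] unfolding L_def by simp
  \<comment> \<open>As the largest unsettled index, \<open>w\<close> has only settled ones above it,
    so it may join \<open>U\<close> once it has been reset.\<close>
  define w where "w = Max (A - U)"
  have w: "w \<in> A" "w \<notin> U" and wmax: "\<And>j. j \<in> A \<Longrightarrow> w < j \<Longrightarrow> j \<in> U"
    using Max_in[of "A - U"] Max_ge[of "A - U"] A \<open>A - U \<noteq> {}\<close> unfolding w_def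
    by (auto simp: not_le[symmetric])
  define U' where "U' = insert w U"
  have U': "U' \<subseteq> A" "\<forall>i\<in>U'. \<forall>j\<in>A. i < j \<longrightarrow> j \<in> U'"
    unfolding U'_def using w wmax Suc.prems by auto
  have cardU': "card (A - U') = k"
  proof -
    have "A - U' = (A - U) - {w}" by (auto simp: U'_def)
    then show ?thesis using w Suc.prems(3) A by simp
  qed
  \<comment> \<open>If the changed index lies in \<open>V\<close>, so do all larger ones, and
    \<open>settled_reset\<close> puts its new coefficient below its weight.\<close>
  have inv: "settled A L (c (Suc n')) t V"
    if "settled A L (c n') t V" "V \<subseteq> A" "\<forall>i\<in>V. \<forall>j\<in>A. i < j \<longrightarrow> j \<in> V" "0 \<le> t" for n' t V
    unfolding settled_def
  proof
    fix i assume i: "i \<in> V"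
    obtain e where e: "e \<in> A" "\<forall>j\<in>A. j \<noteq> e \<longrightarrow> c (Suc n') j = c n' j"
      "\<bar>c (Suc n') e\<bar> \<le> C * (\<Sum>j\<in>{j\<in>A. e < j}. \<bar>c n' j\<bar>)" using step by blast
    show "\<bar>c (Suc n') i\<bar> \<le> t * L ^ card {j\<in>A. i < j}"
    proof (cases "i = e")
      case True
      have "settled A L (c n') t {j\<in>A. e < j}"
        using that(1) that(3) i True unfolding settled_def by blast
      then show ?thesis
        using settled_reset[OF A e(1), of C "c n'" t] e(3) C that True by (simp add: L_def)
    next
      case False
      then show ?thesis using e(2) i that by (auto simp: settled_def)
    qed
  qed
  have setU: "settled A L (c (n + d)) s U" for d
    using Suc.prems by (induction d) (auto intro!: inv)
  show ?case
  \<comment> \<open>Either \<open>w\<close> settles at level \<open>s\<close> within this window,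
    and the induction hypothesis finishes in \<open>settle_time P k\<close> further steps, or the
    norm has dropped to \<open>Q * s\<close> before the window ends.\<close>
  proof (cases "\<exists>d\<le>settle_time P k + P (Suc k). settled A L (c (n + d)) s U'")
    case True
    then obtain d where d: "d \<le> settle_time P k + P (Suc k)" "settled A L (c (n + d)) s U'" by blast
    from Suc.IH[OF U' cardU' Suc.prems(4) d(2)] obtain n' where
      "n' \<ge> n + d" "n' \<le> n + d + settle_time P k" "r n' \<le> Q * s" by blast
    then show ?thesis using d(1) by (intro exI[of _ n']) auto
  next
    case False
    \<comment> \<open>Selecting \<open>w\<close> would settle it at level \<open>s\<close>, since
      all larger indices are settled; hence it is not selected.\<close>
    have cw: "c (n + d) w = c n w" if "d \<le> settle_time P k + P (Suc k)" for d
      using that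
    proof (induction d)
      case (Suc d)
      obtain e where e: "e \<in> A" "\<forall>j\<in>A. j \<noteq> e \<longrightarrow> c (Suc (n + d)) j = c (n + d) j"
        "\<bar>c (Suc (n + d)) e\<bar> \<le> C * (\<Sum>j\<in>{j\<in>A. e < j}. \<bar>c (n + d) j\<bar>)" using step by blast
      have "e \<noteq> w"
      proof
        assume "e = w"
        have "settled A L (c (n + d)) s {j\<in>A. e < j}"
          using setU[of d] wmax \<open>e = w\<close> unfolding settled_def by blast
        then have "\<bar>c (Suc (n + d)) w\<bar> \<le> s * L ^ card {j\<in>A. w < j}"
          using settled_reset[OF A e(1), of C "c (n + d)" s] e(3) C \<open>0 \<le> s\<close> \<open>e = w\<close> by (simp add: L_def)
        then have "settled A L (c (n + Suc d)) s U'"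
          using setU[of "Suc d"] by (auto simp: settled_def U'_def)
        then show False using False Suc.prems by blast
      qed
      then have "c (Suc (n + d)) w = c (n + d) w" using e w by auto
      then show ?case using Suc by simp
    qed simp
    define t where "t = \<bar>c n w\<bar>"
    have "\<not> settled A L (c n) s U'" using False by (metis add.right_neutral zero_le)
    then have "s * L ^ card {j\<in>A. w < j} < t"
      using Suc.prems(5) by (auto simp: settled_def U'_def t_def)
    moreover have pw: "1 \<le> L ^ card {j\<in>A. i < j}" for i using L by (rule one_le_power)
    then have "s * 1 \<le> s * L ^ card {j\<in>A. w < j}" using \<open>0 \<le> s\<close> by (intro mult_left_mono) auto
    ultimately have st: "s < t" by simp
    have "settled A L (c n) t U'"
      unfolding settled_def
    proof
      fix i assume i: "i \<in> U'"
      show "\<bar>c n i\<bar> \<le> t * L ^ card {j\<in>A. i < j}"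
      proof (cases "i = w")
        case True
        then show ?thesis using mult_left_mono[OF pw[of w], of t] by (simp add: t_def)
      next
        case False
        then have "\<bar>c n i\<bar> \<le> s * L ^ card {j\<in>A. i < j}"
          using i Suc.prems(5) by (auto simp: settled_def U'_def)
        also have "\<dots> \<le> t * L ^ card {j\<in>A. i < j}"
          using st L by (intro mult_right_mono) auto
        finally show ?thesis .
      qed
    qed
    then obtain n' where n': "n' \<ge> n" "n' \<le> n + settle_time P k" "r n' \<le> Q * t"
      using Suc.IH[OF U' cardU'] st \<open>0 \<le> s\<close> by (meson order.strict_implies_order order_trans)
    show ?thesis
    proof (rule ccontr)
      assume contr: "\<not> ?thesis"
      \<comment> \<open>While the norm exceeds \<open>Q * s\<close>, the set \<open>U\<close>
        carries at most half of it, so \<open>decr\<close> applies with \<open>W = A - U\<close> and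
        yields geometric decay.\<close>
      have "r (n' + d) \<le> \<rho> (Suc k) ^ d * (Q * t)" if "d \<le> P (Suc k)" for d
        using that
      proof (induction d)
        case 0 then show ?case using n' by simp
      next
        case (Suc d)
        have "n' + d \<le> n + settle_time P (Suc k)" using Suc.prems n' by simp
        then have "Q * s < r (n' + d)"
          using contr n'(1) by (meson not_le trans_le_add1)
        moreover have "(\<Sum>i\<in>U. \<bar>c (n' + d) i\<bar>) \<le> s * (real (card A) * L ^ card A)"
          using settled_sum[OF A \<open>U \<subseteq> A\<close> _ L \<open>0 \<le> s\<close>] setU[of "n' + d - n"] n' by simp
        moreover have "2 * (s * (real (card A) * L ^ card A)) \<le> Q * s"
          unfolding Q_def using cA L \<open>0 \<le> s\<close> by (simp add: mult_ac)
        ultimately have "2 * (\<Sum>i\<in>U. \<bar>c (n' + d) i\<bar>) \<le> r (n' + d)" by linarith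
        moreover have "A - (A - U) = U" using \<open>U \<subseteq> A\<close> by auto
        ultimately have "r (Suc (n' + d)) \<le> \<rho> (card (A - U)) * r (n' + d)"
          using \<open>A - U \<noteq> {}\<close> by (intro decr) auto
        also have "\<dots> \<le> \<rho> (Suc k) * (\<rho> (Suc k) ^ d * (Q * t))"
          using Suc rho \<open>card (A - U) = Suc k\<close> by (auto intro!: mult_left_mono)
        finally show ?case by simp
      qed
      then have "r (n' + P (Suc k)) \<le> \<rho> (Suc k) ^ P (Suc k) * (Q * t)" by simp
      moreover have "n' - n + P (Suc k) \<le> settle_time P k + P (Suc k)" using n' by simp
      \<comment> \<open>The coefficient of \<open>w\<close> is still of size \<open>t\<close> and
        bounded by the norm, whereas the choice of \<open>P\<close> pushes the norm below
        \<open>t\<close>.\<close>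
      then have "t \<le> r (n' + P (Suc k))"
        using coeff[OF w(1), of "n' + P (Suc k)"] cw[of "n' - n + P (Suc k)"] n' by (simp add: t_def)
      ultimately have "1 * t \<le> (\<rho> (Suc k) ^ P (Suc k) * Q) * t" by (simp add: mult_ac)
      then show False using rho(2)[of "Suc k"] st \<open>0 \<le> s\<close> by (auto simp: mult_le_cancel_right)
    qed
  qed
qed

text \<open>The recurrence \<open>x (k + 1) = 2 * x k + a * (k + 1)^2\<close> with
  \<open>x 0 = 0\<close> has the solution \<open>a * (6 * 2 ^ k - (k^2 + 4 * k + 6))\<close>;
  dropping the subtracted polynomial gives the bound.\<close>

lemma settle_time_bound:
  fixes a :: real
  assumes "0 \<le> a" "\<And>k. 1 \<le> k \<Longrightarrow> k \<le> m \<Longrightarrow> real (P k) \<le> a * (real k)\<^sup>2"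
  shows "real (settle_time P m) \<le> 6 * a * 2 ^ m"
proof -
  have "real (settle_time P k) \<le> a * (6 * 2 ^ k - ((real k)\<^sup>2 + 4 * real k + 6))" if "k \<le> m" for k
    using that
  proof (induction k)
    case (Suc k)
    have "real (settle_time P (Suc k)) \<le> 2 * (a * (6 * 2 ^ k - ((real k)\<^sup>2 + 4 * real k + 6))) + a * (real (Suc k))\<^sup>2"
      using Suc assms(2)[of "Suc k"] by simp
    also have "\<dots> = a * (6 * 2 ^ Suc k - ((real (Suc k))\<^sup>2 + 4 * real (Suc k) + 6))"
      by (simp add: algebra_simps power2_eq_square)
    finally show ?case .
  qed simp
  from this[of m] have "real (settle_time P m) \<le> a * (6 * 2 ^ m - ((real m)\<^sup>2 + 4 * real m + 6))" by simp
  also have "\<dots> \<le> a * (6 * 2 ^ m)"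
    using assms(1) zero_le_power2[of "real m"] by (intro mult_left_mono) linarith+
  finally show ?thesis by (simp add: mult_ac)
qed

section \<open>Greedy steps\<close>

definition decrease_const :: "real \<Rightarrow> real" where
  "decrease_const p = (p - 1) * 2 powr (p + 1)"

lemma decrease_const_ge_1: "2 \<le> p \<Longrightarrow> 1 \<le> decrease_const p"
  using mult_mono[of 1 "p - 1" 1 "2 powr (p + 1)"] by (simp add: decrease_const_def ge_one_powr_ge_zero)

text \<open>The value of the norming functional of \<open>y\<close> at the \<open>i\<close>-th
  dictionary element, identified in \<open>norming_functional_haar\<close>.\<close>

definition norming_coeff :: "real \<Rightarrow> (real \<Rightarrow> real) \<Rightarrow> nat \<Rightarrow> real" where
  "norming_coeff p y i = lp_dual p y (haar_normalized p i) / Lp_norm p y powr (p - 1)"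

definition reset_factor :: "real \<Rightarrow> real" where
  "reset_factor p = max 1 (reset_const p powr (1 / p))"

text \<open>The interface shared by both algorithms: one coefficient is reset, and the norm
  decreases at least as much as the quadratic bound promises for any dictionary element.\<close>

definition good_step :: "real \<Rightarrow> nat set \<Rightarrow> (real \<Rightarrow> real) \<Rightarrow> (real \<Rightarrow> real) \<Rightarrow> bool" where
  "good_step p A y z \<longleftrightarrow> z \<in> haar_space p A \<and>
     (\<exists>i\<in>A. (\<forall>j\<in>A. j \<noteq> i \<longrightarrow> haar_coeff p j z = haar_coeff p j y) \<and>
       \<bar>haar_coeff p i z\<bar> \<le> reset_factor p * (\<Sum>j\<in>{j\<in>A. i < j}. \<bar>haar_coeff p j y\<bar>)) \<and>
     (\<forall>j\<in>A. Lp_norm p z \<le> Lp_norm p y * (1 - (norming_coeff p y j)\<^sup>2 / (4 * decrease_const p)))"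

section \<open>The Haar space and its norming functionals\<close>

lemma bounded_borel_haar_space: "finite A \<Longrightarrow> y \<in> haar_space p A \<Longrightarrow> bounded_borel y"
  using haar_space_iff[of A y p] by auto

lemma haar_dict_subset_space: "haar_dict p A \<subseteq> haar_space p A"
  unfolding haar_space_def by (rule span_superset)

lemma subspace_haar_space: "subspace (haar_space p A)"
  unfolding haar_space_def by (rule subspace_span)

lemma haar_space_eq_0:
  assumes "2 \<le> p" "finite A" "y \<in> haar_space p A" "Lp_norm p y = 0"
  shows "y = 0"
proof -
  have "haar_coeff p i y = 0" for i
    using abs_haar_coeff_le[OF assms(1) bounded_borel_haar_space[OF assms(2,3)], of i] assms(4) by simp
  then have "y = haar_sum p A (\<lambda>i. 0)" using haar_expansion[OF assms(1-3)] by simp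
  then show ?thesis by (simp add: haar_sum_def fun_eq_iff)
qed

lemma Lp_norm_pos:
  assumes "2 \<le> p" "finite A" "y \<in> haar_space p A" "y \<noteq> 0"
  shows "0 < Lp_norm p y"
  using haar_space_eq_0[OF assms(1-3)] assms(4) Lp_norm_nonneg[of p y] by fastforce

lemma norming_functional_le:
  assumes p: "2 \<le> p" and A: "finite A" and F: "norming_functional (haar_space p A) (Lp_norm p) y F"
    and x: "x \<in> haar_space p A"
  shows "F x \<le> Lp_norm p x"
proof -
  let ?X = "haar_space p A" and ?N = "Lp_norm p"
  have add: "F (x + y) = F x + F y" if "x \<in> ?X" "y \<in> ?X" for x y
    using F that by (simp add: norming_functional_def linear_functional_on_def)
  have scale: "F (c *\<^sub>R x) = c * F x" if "x \<in> ?X" for c x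
    using F that by (simp add: norming_functional_def linear_functional_on_def)
  have phi: "haar_normalized p i \<in> ?X" if "i \<in> A" for i
    using haar_dict_subset_space[of p A] that by (auto simp: haar_dict_def)
  have F0: "F 0 = 0" using scale[of 0 0] subspace_0[OF subspace_haar_space] by simp
  have Fsum: "F (\<Sum>i\<in>B. c i *\<^sub>R haar_normalized p i) = (\<Sum>i\<in>B. c i * F (haar_normalized p i))"
    if "finite B" "B \<subseteq> A" for B c
    using that
  proof (induction B rule: finite_induct)
    case (insert b B)
    have S: "(\<Sum>i\<in>B. c i *\<^sub>R haar_normalized p i) \<in> ?X"
      using insert phi by (intro subspace_sum[OF subspace_haar_space] subspace_scale[OF subspace_haar_space]) auto
    have b: "c b *\<^sub>R haar_normalized p b \<in> ?X"
      using insert phi by (intro subspace_scale[OF subspace_haar_space]) auto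
    show ?case
      unfolding sum.insert[OF insert.hyps] add[OF b S] using insert phi by (simp add: scale)
  qed (simp add: F0)
  \<comment> \<open>The supremum in \<open>dual_norm\<close> bounds its members only if they are
    bounded above. They are, since every Haar coefficient is at most the norm.\<close>
  have bdd: "bdd_above ((\<lambda>x. \<bar>F x\<bar>) ` {x \<in> ?X. ?N x \<le> 1})"
  proof (rule bdd_aboveI2)
    fix x assume "x \<in> {x \<in> ?X. ?N x \<le> 1}"
    then have x: "x \<in> ?X" "?N x \<le> 1" by auto
    have "F x = (\<Sum>i\<in>A. haar_coeff p i x * F (haar_normalized p i))"
      using haar_expansion[OF p A x(1)] Fsum[OF A order_refl] haar_sum_eq_sum[OF A] by metis
    also have "\<bar>\<dots>\<bar> \<le> (\<Sum>i\<in>A. \<bar>haar_coeff p i x * F (haar_normalized p i)\<bar>)" by (rule sum_abs)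
    also have "\<dots> \<le> (\<Sum>i\<in>A. 1 * \<bar>F (haar_normalized p i)\<bar>)"
    proof (rule sum_mono)
      fix i
      have "\<bar>haar_coeff p i x\<bar> \<le> 1"
        using abs_haar_coeff_le[OF p bounded_borel_haar_space[OF A x(1)], of i] x(2) by linarith
      then show "\<bar>haar_coeff p i x * F (haar_normalized p i)\<bar> \<le> 1 * \<bar>F (haar_normalized p i)\<bar>"
        unfolding abs_mult by (rule mult_right_mono) simp
    qed
    finally show "\<bar>F x\<bar> \<le> (\<Sum>i\<in>A. 1 * \<bar>F (haar_normalized p i)\<bar>)" .
  qed
  show ?thesis
  proof (cases "?N x = 0")
    case True
    then show ?thesis using haar_space_eq_0[OF p A x] F0 by simp
  next
    case False
    then have N: "0 < ?N x" using Lp_norm_nonneg[of p x] by linarith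
    have u: "(1 / ?N x) *\<^sub>R x \<in> ?X" using x by (intro subspace_scale[OF subspace_haar_space])
    moreover have "?N ((1 / ?N x) *\<^sub>R x) = 1"
      using Lp_norm_scale[of p "1 / ?N x" x] p N by (simp add: scaleR_fun_def)
    ultimately have "\<bar>F ((1 / ?N x) *\<^sub>R x)\<bar> \<le> dual_norm ?X ?N F"
      unfolding dual_norm_def by (intro cSUP_upper[OF _ bdd]) auto
    then have "\<bar>F ((1 / ?N x) *\<^sub>R x)\<bar> \<le> 1" using F by (simp add: norming_functional_def)
    then have "\<bar>F x\<bar> \<le> ?N x" using N scale[OF x] by (simp add: abs_mult field_simps)
    then show ?thesis by linarith
  qed
qed

text \<open>Smoothness at work: \<open>F\<close> is a lower bound for the norm that is sharp at
  \<open>y\<close>, and \<open>Lp_norm_diff_quadratic\<close> is an upper bound for it near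
  \<open>y\<close>, so their linear terms along the dictionary element agree.\<close>

lemma norming_functional_haar:
  assumes p: "2 \<le> p" and A: "finite A" "i \<in> A" and y: "y \<in> haar_space p A" "y \<noteq> 0"
    and F: "norming_functional (haar_space p A) (Lp_norm p) y F"
  shows "F (haar_normalized p i) = norming_coeff p y i"
proof -
  let ?f = "haar_normalized p i" and ?r = "Lp_norm p y"
  have r: "0 < ?r" using Lp_norm_pos[OF p A(1) y] .
  have f: "?f \<in> haar_space p A"
    using haar_dict_subset_space[of p A] A by (auto simp: haar_dict_def)
  have "norming_coeff p y i - F ?f = 0"
  proof (rule linear_le_quadratic_imp_0[of "decrease_const p"])
    fix \<mu> :: real assume mu: "\<bar>\<mu>\<bar> \<le> 1"
    have lin: "F (a + b) = F a + F b" "F (c *\<^sub>R a) = c * F a" if "a \<in> haar_space p A" "b \<in> haar_space p A" for a b c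
      using F that by (simp_all add: norming_functional_def linear_functional_on_def)
    have s: "(- (?r * \<mu>)) *\<^sub>R ?f \<in> haar_space p A"
      using f by (intro subspace_scale[OF subspace_haar_space])
    have "?r - ?r * \<mu> * F ?f = F (y + (- (?r * \<mu>)) *\<^sub>R ?f)"
      unfolding lin(1)[OF y(1) s] lin(2)[OF f f] using F by (simp add: norming_functional_def)
    also have "\<dots> \<le> Lp_norm p (y + (- (?r * \<mu>)) *\<^sub>R ?f)"
      using s y by (intro norming_functional_le[OF p A(1) F] subspace_add[OF subspace_haar_space])
    also have "y + (- (?r * \<mu>)) *\<^sub>R ?f = (\<lambda>t. y t - ?r * \<mu> * ?f t)"
      by (simp add: fun_eq_iff scaleR_fun_def)
    also have "Lp_norm p \<dots> \<le> ?r * (1 - \<mu> * norming_coeff p y i + decrease_const p * \<mu>\<^sup>2)"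
      unfolding norming_coeff_def decrease_const_def
      using p r mu by (intro Lp_norm_diff_quadratic bounded_borel_haar_space[OF A(1) y(1)]) (auto simp: Lp_norm_haar_normalized)
    finally have "?r * (1 - \<mu> * F ?f) \<le> ?r * (1 - \<mu> * norming_coeff p y i + decrease_const p * \<mu>\<^sup>2)"
      by (simp add: algebra_simps)
    then have "1 - \<mu> * F ?f \<le> 1 - \<mu> * norming_coeff p y i + decrease_const p * \<mu>\<^sup>2"
      using r by (simp only: mult_le_cancel_left_pos)
    then show "\<mu> * (norming_coeff p y i - F ?f) \<le> decrease_const p * \<mu>\<^sup>2"
      by (simp add: algebra_simps)
  qed (use decrease_const_ge_1[OF p] in simp)
  then show ?thesis by simp
qed

text \<open>Minimality of the step length makes the new vector minimal along the chosen element, so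
  \<open>haar_coeff_reset\<close> applies to it. The coefficients of larger index on the right are
  untouched by the step.\<close>

lemma good_step_of_minimal:
  assumes p: "2 \<le> p" and A: "finite A" "i \<in> A" and y: "y \<in> haar_space p A"
    and min: "\<forall>l'. Lp_norm p (y - l *\<^sub>R haar_normalized p i) \<le> Lp_norm p (y - l' *\<^sub>R haar_normalized p i)"
    and decr: "\<And>j. j \<in> A \<Longrightarrow> Lp_norm p (y - l *\<^sub>R haar_normalized p i) \<le> Lp_norm p y * (1 - (norming_coeff p y j)\<^sup>2 / (4 * decrease_const p))"
  shows "good_step p A y (y - l *\<^sub>R haar_normalized p i)"
proof -
  define c where "c = (\<lambda>j. haar_coeff p j y)"
  define d where "d = c(i := c i - l)"
  have yc: "y = haar_sum p A c" unfolding c_def using haar_expansion[OF p A(1) y] .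
  have z: "y - l *\<^sub>R haar_normalized p i = haar_sum p A d"
    unfolding yc d_def by (rule haar_sum_diff[OF A])
  have coeff: "haar_coeff p j (haar_sum p A d) = d j" if "j \<in> A" for j
    using haar_coeff_haar_sum[OF p A(1)] that by simp
  have "\<bar>d i\<bar> \<le> max 1 (reset_const p powr (1 / p)) * (\<Sum>j\<in>{j\<in>A. i < j}. \<bar>d j\<bar>)"
  proof (rule haar_coeff_reset[OF p A])
    fix s
    have "haar_sum p A d - s *\<^sub>R haar_normalized p i = y - (l + s) *\<^sub>R haar_normalized p i"
      unfolding z[symmetric] by (simp add: scaleR_left_distrib)
    then show "Lp_norm p (haar_sum p A d) \<le> Lp_norm p (haar_sum p A d - s *\<^sub>R haar_normalized p i)"
      using min z by simp
  qed
  also have "(\<Sum>j\<in>{j\<in>A. i < j}. \<bar>d j\<bar>) = (\<Sum>j\<in>{j\<in>A. i < j}. \<bar>c j\<bar>)"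
    by (intro sum.cong) (auto simp: d_def)
  finally have "\<bar>haar_coeff p i (haar_sum p A d)\<bar> \<le> reset_factor p * (\<Sum>j\<in>{j\<in>A. i < j}. \<bar>haar_coeff p j y\<bar>)"
    using coeff[OF A(2)] by (simp add: reset_factor_def c_def)
  moreover have "\<forall>j\<in>A. j \<noteq> i \<longrightarrow> haar_coeff p j (haar_sum p A d) = haar_coeff p j y"
    using coeff by (simp add: d_def c_def)
  moreover have "haar_sum p A d \<in> haar_space p A" using haar_space_iff[OF A(1)] by blast
  ultimately show ?thesis using decr A(2) unfolding good_step_def z by blast
qed

section \<open>Both algorithms take good steps\<close>

lemma best_haar_step:
  assumes p: "2 \<le> p" and A: "finite A" and y: "y \<in> haar_space p A" "y \<noteq> 0"
  shows "\<exists>s. Lp_norm p (y - s *\<^sub>R haar_normalized p j) \<le> Lp_norm p y * (1 - (norming_coeff p y j)\<^sup>2 / (4 * decrease_const p))"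
proof -
  have "(\<lambda>t. y t - s * haar_normalized p j t) = y - s *\<^sub>R haar_normalized p j" for s
    by (simp add: fun_eq_iff scaleR_fun_def)
  then show ?thesis
    using Lp_norm_best_step[OF p bounded_borel_haar_space[OF A y(1)] bounded_borel_haar_normalized Lp_norm_pos[OF p A y], of p j] p
    by (simp add: Lp_norm_haar_normalized norming_coeff_def decrease_const_def)
qed

text \<open>The selection makes the chosen step at least as good as every step along every
  dictionary element, in particular those of \<open>best_haar_step\<close>.\<close>

lemma good_step_xga:
  assumes p: "2 \<le> p" and A: "finite A" and y: "y \<in> haar_space p A" "y \<noteq> 0"
    and step: "greedy_step (xga_select (Lp_norm p) (haar_dict p A)) (Lp_norm p) y z"
  shows "good_step p A y z"
proof -
  let ?N = "Lp_norm p" and ?D = "haar_dict p A"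
  obtain \<phi> l where sel: "xga_select ?N ?D y \<phi>" and min: "\<forall>l'. ?N (y - l *\<^sub>R \<phi>) \<le> ?N (y - l' *\<^sub>R \<phi>)"
    and z: "z = y - l *\<^sub>R \<phi>"
    using step by (auto simp: greedy_step_def)
  obtain i where i: "i \<in> A" "\<phi> = haar_normalized p i"
    using sel by (auto simp: xga_select_def haar_dict_def)
  have opt: "?N (y - l *\<^sub>R \<phi>) \<le> ?N (y - s *\<^sub>R haar_normalized p j)" if "j \<in> A" for s j
  proof -
    have "?N (y - l *\<^sub>R \<phi>) \<le> (INF l. ?N (y - l *\<^sub>R \<phi>))"
      using min by (intro cINF_greatest) auto
    also have "\<dots> = (INF (l, \<psi>)\<in>UNIV \<times> ?D. ?N (y - l *\<^sub>R \<psi>))"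
      using sel by (simp add: xga_select_def)
    also have "\<dots> \<le> (case (s, haar_normalized p j) of (l, \<psi>) \<Rightarrow> ?N (y - l *\<^sub>R \<psi>))"
      using that by (intro cINF_lower bdd_belowI2[of _ 0]) (auto simp: Lp_norm_nonneg haar_dict_def)
    finally show ?thesis by simp
  qed
  show ?thesis
    unfolding z i(2)
  proof (rule good_step_of_minimal[OF p A i(1) y(1)])
    fix j assume "j \<in> A"
    obtain s where "?N (y - s *\<^sub>R haar_normalized p j) \<le> ?N y * (1 - (norming_coeff p y j)\<^sup>2 / (4 * decrease_const p))"
      using best_haar_step[OF p A y] by blast
    with opt[OF \<open>j \<in> A\<close>, of s] i(2)
    show "?N (y - l *\<^sub>R haar_normalized p i) \<le> ?N y * (1 - (norming_coeff p y j)\<^sup>2 / (4 * decrease_const p))"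
      by simp
  qed (use min i(2) in simp)
qed

text \<open>The selected \<open>i\<close> maximises the size of \<open>norming_coeff p y\<close>, so
  the decrease guaranteed along it dominates that for any other \<open>j\<close>; the line search
  does at least as well.\<close>

lemma good_step_dga:
  assumes p: "2 \<le> p" and A: "finite A" and y: "y \<in> haar_space p A" "y \<noteq> 0"
    and step: "greedy_step (dga_select (haar_space p A) (Lp_norm p) (haar_dict p A)) (Lp_norm p) y z"
  shows "good_step p A y z"
proof -
  let ?N = "Lp_norm p" and ?D = "haar_dict p A"
  obtain \<phi> l where sel: "dga_select (haar_space p A) ?N ?D y \<phi>" and min: "\<forall>l'. ?N (y - l *\<^sub>R \<phi>) \<le> ?N (y - l' *\<^sub>R \<phi>)"
    and z: "z = y - l *\<^sub>R \<phi>"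
    using step by (auto simp: greedy_step_def)
  obtain F where F: "norming_functional (haar_space p A) ?N y F" "\<bar>F \<phi>\<bar> = Max ((\<lambda>\<psi>. \<bar>F \<psi>\<bar>) ` ?D)"
    using sel by (auto simp: dga_select_def)
  obtain i where i: "i \<in> A" "\<phi> = haar_normalized p i"
    using sel by (auto simp: dga_select_def haar_dict_def)
  show ?thesis
    unfolding z i(2)
  proof (rule good_step_of_minimal[OF p A i(1) y(1)])
    fix j assume j: "j \<in> A"
    have "\<bar>F (haar_normalized p j)\<bar> \<le> \<bar>F \<phi>\<bar>"
      unfolding F(2) using A j by (intro Max_ge) (auto simp: haar_dict_def)
    then have "(norming_coeff p y j)\<^sup>2 \<le> (norming_coeff p y i)\<^sup>2"
      using norming_functional_haar[OF p A _ y F(1)] i j by (simp add: abs_le_square_iff)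
    then have "(norming_coeff p y j)\<^sup>2 / (4 * decrease_const p) \<le> (norming_coeff p y i)\<^sup>2 / (4 * decrease_const p)"
      using decrease_const_ge_1[OF p] by (intro divide_right_mono) auto
    then have "?N y * (1 - (norming_coeff p y i)\<^sup>2 / (4 * decrease_const p)) \<le> ?N y * (1 - (norming_coeff p y j)\<^sup>2 / (4 * decrease_const p))"
      by (intro mult_left_mono) (auto simp: Lp_norm_nonneg)
    moreover obtain s where "?N (y - s *\<^sub>R haar_normalized p i) \<le> ?N y * (1 - (norming_coeff p y i)\<^sup>2 / (4 * decrease_const p))"
      using best_haar_step[OF p A y] by blast
    ultimately show "?N (y - l *\<^sub>R haar_normalized p i) \<le> ?N y * (1 - (norming_coeff p y j)\<^sup>2 / (4 * decrease_const p))"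
      using min[rule_format, of s] i(2) by simp
  qed (use min i(2) in simp)
qed

section \<open>Geometric decrease and the iteration count\<close>

definition decrease_rate :: "real \<Rightarrow> nat \<Rightarrow> real" where
  "decrease_rate p k = 1 - 1 / (16 * decrease_const p * (real k)\<^sup>2)"

text \<open>Applying the norming functional to \<open>y\<close> writes the norm \<open>r\<close> as
  a sum of coefficients times values of absolute value at most 1. Indices outside \<open>W\<close>
  contribute at most \<open>r / 2\<close>. As each coefficient is at most \<open>r\<close>, some
  index in \<open>W\<close> has value at least \<open>1 / (2 * card W)\<close>.\<close>

lemma good_step_decrease:
  assumes p: "2 \<le> p" and A: "finite A" and y: "y \<in> haar_space p A" and step: "good_step p A y z"
    and W: "W \<subseteq> A" "W \<noteq> {}" and small: "2 * (\<Sum>i\<in>A - W. \<bar>haar_coeff p i y\<bar>) \<le> Lp_norm p y"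
  shows "Lp_norm p z \<le> decrease_rate p (card W) * Lp_norm p y"
proof -
  define r where "r = Lp_norm p y"
  have dec: "Lp_norm p z \<le> r * (1 - (norming_coeff p y j)\<^sup>2 / (4 * decrease_const p))" if "j \<in> A" for j
    using step that by (simp add: good_step_def r_def)
  show ?thesis
  proof (cases "r = 0")
    case True
    then show ?thesis using dec W by (auto simp: r_def)
  next
    case False
    then have r: "0 < r" using Lp_norm_nonneg[of p y] by (simp add: r_def)
    have fW: "finite W" using W A finite_subset by blast
    then have k: "0 < real (card W)" using W by (simp add: card_gt_0_iff)
    have bb: "bounded_borel y" using bounded_borel_haar_space[OF A y] .
    have "r powr (p - 1) * r = lp_dual p y y"
      using p r by (simp add: lp_dual_self r_def powr_mult_base mult.commute)
    also have "\<dots> = lp_dual p y (haar_sum p A (\<lambda>i. haar_coeff p i y))"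
      using haar_expansion[OF p A y] by simp
    also have "\<dots> = (\<Sum>i\<in>A. haar_coeff p i y * lp_dual p y (haar_normalized p i))"
      by (rule lp_dual_haar_sum[OF p bb])
    also have "\<dots> = r powr (p - 1) * (\<Sum>i\<in>A. haar_coeff p i y * norming_coeff p y i)"
      using r by (simp add: norming_coeff_def r_def sum_distrib_left)
    finally have "r = (\<Sum>i\<in>A. haar_coeff p i y * norming_coeff p y i)" using r by simp
    also have "\<dots> = (\<Sum>i\<in>A - W. haar_coeff p i y * norming_coeff p y i) + (\<Sum>i\<in>W. haar_coeff p i y * norming_coeff p y i)"
      using A W by (intro sum.subset_diff) auto
    finally have split: "r = (\<Sum>i\<in>A - W. haar_coeff p i y * norming_coeff p y i) + (\<Sum>i\<in>W. haar_coeff p i y * norming_coeff p y i)" .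
    have "\<bar>norming_coeff p y i\<bar> \<le> 1" for i
      using lp_dual_holder[OF p bb bounded_borel_haar_normalized, of p i] p r
      by (simp add: norming_coeff_def Lp_norm_haar_normalized r_def divide_le_eq)
    then have "(\<Sum>i\<in>A - W. haar_coeff p i y * norming_coeff p y i) \<le> (\<Sum>i\<in>A - W. \<bar>haar_coeff p i y\<bar>)"
      by (intro sum_mono) (metis abs_ge_self abs_ge_zero abs_mult mult_left_le order_trans)
    then have half: "r / 2 \<le> (\<Sum>i\<in>W. haar_coeff p i y * norming_coeff p y i)"
      using split small by (simp add: r_def)
    have "\<exists>j\<in>W. 1 / (2 * real (card W)) \<le> \<bar>norming_coeff p y j\<bar>"
    proof (rule ccontr)
      assume contr: "\<not> ?thesis"
      have "(\<Sum>i\<in>W. haar_coeff p i y * norming_coeff p y i) < (\<Sum>i\<in>W. r * (1 / (2 * real (card W))))"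
      proof (rule sum_strict_mono[OF fW W(2)])
        fix i assume "i \<in> W"
        then have "\<bar>norming_coeff p y i\<bar> < 1 / (2 * real (card W))" using contr by auto
        then have "r * \<bar>norming_coeff p y i\<bar> < r * (1 / (2 * real (card W)))"
          using r by (rule mult_strict_left_mono)
        moreover have "\<bar>haar_coeff p i y\<bar> * \<bar>norming_coeff p y i\<bar> \<le> r * \<bar>norming_coeff p y i\<bar>"
          using abs_haar_coeff_le[OF p bb, of i] by (intro mult_right_mono) (auto simp: r_def)
        moreover have "haar_coeff p i y * norming_coeff p y i \<le> \<bar>haar_coeff p i y\<bar> * \<bar>norming_coeff p y i\<bar>"
          by (metis abs_ge_self abs_mult)
        ultimately show "haar_coeff p i y * norming_coeff p y i < r * (1 / (2 * real (card W)))" by linarith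
      qed
      also have "\<dots> = r / 2" using k by simp
      finally show False using half by simp
    qed
    then obtain j where j: "j \<in> W" "1 / (2 * real (card W)) \<le> \<bar>norming_coeff p y j\<bar>" by blast
    have "(1 / (2 * real (card W)))\<^sup>2 \<le> \<bar>norming_coeff p y j\<bar>\<^sup>2"
      using j k by (intro power_mono) auto
    then have "(1 / (2 * real (card W)))\<^sup>2 / (4 * decrease_const p) \<le> (norming_coeff p y j)\<^sup>2 / (4 * decrease_const p)"
      using decrease_const_ge_1[OF p] by (intro divide_right_mono) auto
    also have "(1 / (2 * real (card W)))\<^sup>2 / (4 * decrease_const p) = 1 - decrease_rate p (card W)"
      by (simp add: decrease_rate_def power_divide power_mult_distrib)
    finally have "r * (1 - (norming_coeff p y j)\<^sup>2 / (4 * decrease_const p)) \<le> r * decrease_rate p (card W)"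
      using r by (intro mult_left_mono) auto
    then show ?thesis using dec[of j] j W by (auto simp: r_def mult.commute)
  qed
qed

text \<open>The successor makes it strictly larger than \<open>D * ln Q\<close> with
  \<open>D = 16 * decrease_const p * k^2\<close>, so that
  \<open>(1 - 1 / D) ^ n \<le> exp (- n / D) < 1 / Q\<close> for this number
  \<open>n\<close>.\<close>

definition phase_length :: "real \<Rightarrow> real \<Rightarrow> nat \<Rightarrow> nat" where
  "phase_length p Q k = Suc (nat \<lfloor>16 * decrease_const p * (real k)\<^sup>2 * ln Q\<rfloor>)"

lemma decrease_rate_nonneg: "2 \<le> p \<Longrightarrow> 0 \<le> decrease_rate p k"
\<comment> \<open>Division by 0 makes the rate 1 for \<open>k = 0\<close>; \<open>settling\<close>
  asks for nonnegativity at every \<open>k\<close>.\<close>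
proof (cases "k = 0")
  case False
  assume "2 \<le> p"
  then have "1 * 1 \<le> 16 * decrease_const p * (real k)\<^sup>2"
    using False decrease_const_ge_1[of p] by (intro mult_mono) auto
  then show ?thesis by (simp add: decrease_rate_def divide_le_eq)
qed (simp add: decrease_rate_def)

lemma decrease_rate_phase:
  assumes p: "2 \<le> p" and Q: "1 \<le> Q" and k: "1 \<le> k"
  shows "decrease_rate p k ^ phase_length p Q k * Q < 1"
proof -
  define D where "D = 16 * decrease_const p * (real k)\<^sup>2"
  have D: "0 < D" using decrease_const_ge_1[OF p] k by (simp add: D_def)
  have "D * ln Q < real (phase_length p Q k)"
    unfolding phase_length_def D_def[symmetric] by linarith
  then have n: "ln Q < real (phase_length p Q k) * (1 / D)" using D by (simp add: field_simps)
  have "decrease_rate p k \<le> exp (- (1 / D))"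
    using exp_ge_add_one_self[of "- (1 / D)"] by (simp add: decrease_rate_def D_def)
  then have "decrease_rate p k ^ phase_length p Q k \<le> exp (- (1 / D)) ^ phase_length p Q k"
    using decrease_rate_nonneg[OF p] by (intro power_mono)
  also have "\<dots> = exp (- (real (phase_length p Q k) * (1 / D)))"
    by (simp add: exp_of_nat_mult[symmetric])
  also have "\<dots> < exp (- ln Q)" using n by simp
  also have "\<dots> = 1 / Q" using Q by (simp add: exp_minus inverse_eq_divide)
  finally show ?thesis using Q by (simp add: field_simps)
qed

lemma phase_length_le:
  assumes "2 \<le> p" "1 \<le> Q" "1 \<le> k"
  shows "real (phase_length p Q k) \<le> (16 * decrease_const p * ln Q + 1) * (real k)\<^sup>2"
proof -
  have "0 \<le> 16 * decrease_const p * (real k)\<^sup>2 * ln Q"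
    using assms decrease_const_ge_1[of p] by (intro mult_nonneg_nonneg) auto
  then have "real (phase_length p Q k) \<le> 16 * decrease_const p * (real k)\<^sup>2 * ln Q + 1"
    unfolding phase_length_def by linarith
  moreover have "1 \<le> (real k)\<^sup>2" using assms(3) by simp
  ultimately show ?thesis by (simp add: algebra_simps)
qed

text \<open>\<open>settling\<close> is started with nothing settled and level 0, so the norm it
  reaches is 0.\<close>

lemma terminates_within_good_step:
  assumes p: "2 \<le> p" and A: "finite A" "A \<noteq> {}" and x: "x \<in> haar_space p A"
    and good: "\<And>y z. y \<in> haar_space p A \<Longrightarrow> y \<noteq> 0 \<Longrightarrow> greedy_step select (Lp_norm p) y z \<Longrightarrow> good_step p A y z"
    and Q: "Q = 2 * (real (card A) * (reset_factor p * real (card A)) ^ card A)"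
  shows "terminates_within select (Lp_norm p) x (6 * (16 * decrease_const p * ln Q + 1) * 2 ^ card A)"
  unfolding terminates_within_def
proof (intro allI impI)
  fix xs assume run: "greedy_run select (Lp_norm p) x xs"
  \<comment> \<open>A run is unconstrained after its first zero; continuing it by 0 gives an
    infinite sequence of good steps, because 0 to 0 is one.\<close>
  define ys where "ys = (\<lambda>n. if \<exists>j\<le>n. xs j = 0 then 0 else xs n)"
  have C: "1 \<le> reset_factor p" by (simp add: reset_factor_def)
  have m: "1 \<le> real (card A)" using A by (simp add: Suc_le_eq card_gt_0_iff)
  then have L: "1 \<le> reset_factor p * real (card A)" using C mult_mono[of 1 "reset_factor p" 1 "real (card A)"] by simp
  then have "1 * 1 \<le> real (card A) * (reset_factor p * real (card A)) ^ card A"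
    using m by (intro mult_mono one_le_power) auto
  then have Q1: "1 \<le> Q" by (simp add: Q)
  have zero: "good_step p A 0 0"
  proof -
    obtain i where "i \<in> A" using A by blast
    moreover have "haar_coeff p j 0 = 0" for j by (simp add: haar_coeff_def lp_dual_def)
    moreover have "Lp_norm p 0 = 0" using p by (simp add: Lp_norm_def set_lebesgue_integral_def)
    moreover have "0 \<in> haar_space p A" using subspace_0[OF subspace_haar_space] .
    ultimately show ?thesis by (auto simp: good_step_def)
  qed
  have ys_step: "good_step p A (ys n) (ys (Suc n))" if yn: "ys n \<in> haar_space p A" for n
  proof (cases "\<exists>j\<le>n. xs j = 0")
    case True
    then have "\<exists>j\<le>Suc n. xs j = 0" using le_SucI by blast
    with True have "ys n = 0" "ys (Suc n) = 0" by (simp_all only: ys_def if_True)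
    then show ?thesis using zero by (simp only:)
  next
    case False
    then have "ys n = xs n" "ys (Suc n) = xs (Suc n)" by (auto simp: ys_def le_Suc_eq)
    moreover have "greedy_step select (Lp_norm p) (xs n) (xs (Suc n))"
      using run False unfolding greedy_run_def by blast
    ultimately show ?thesis using good yn False by simp
  qed
  have ys: "ys n \<in> haar_space p A \<and> good_step p A (ys n) (ys (Suc n))" for n
  proof -
    have "ys n \<in> haar_space p A"
    proof (induction n)
      case 0
      show ?case using run x subspace_0[OF subspace_haar_space] by (auto simp: greedy_run_def ys_def)
    next
      case (Suc n)
      then show ?case using ys_step[of n] by (simp add: good_step_def)
    qed
    then show ?thesis using ys_step by blast
  qed
  have "\<exists>n'\<ge>0. n' \<le> 0 + settle_time (phase_length p Q) (card A) \<and> Lp_norm p (ys n') \<le> Q * 0"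
  proof (rule settling[where c = "\<lambda>n i. haar_coeff p i (ys n)" and U = "{}" and C = "reset_factor p"
        and L = "reset_factor p * real (card A)" and A = A and \<rho> = "decrease_rate p"])
    show "Lp_norm p (ys n) \<le> (\<Sum>i\<in>A. \<bar>haar_coeff p i (ys n)\<bar>)" for n
      using Lp_norm_haar_sum_le[OF p, of A "\<lambda>i. haar_coeff p i (ys n)"] haar_expansion[OF p A(1), of "ys n"] ys[of n] by simp
    show "\<exists>i\<in>A. (\<forall>j\<in>A. j \<noteq> i \<longrightarrow> haar_coeff p j (ys (Suc n)) = haar_coeff p j (ys n)) \<and>
      \<bar>haar_coeff p i (ys (Suc n))\<bar> \<le> reset_factor p * (\<Sum>j\<in>{j\<in>A. i < j}. \<bar>haar_coeff p j (ys n)\<bar>)" for n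
      using ys[of n] by (simp add: good_step_def)
    show "decrease_rate p k ^ phase_length p Q k * Q < 1" if "1 \<le> k" for k
      using decrease_rate_phase[OF p Q1 that] .
    show "Lp_norm p (ys (Suc n)) \<le> decrease_rate p (card W) * Lp_norm p (ys n)"
      if "W \<subseteq> A" "W \<noteq> {}" "2 * (\<Sum>i\<in>A - W. \<bar>haar_coeff p i (ys n)\<bar>) \<le> Lp_norm p (ys n)" for n W
      using good_step_decrease[OF p A(1) _ _ that] ys[of n] by blast
    show "\<bar>haar_coeff p i (ys n)\<bar> \<le> Lp_norm p (ys n)" for n i
      using abs_haar_coeff_le[OF p bounded_borel_haar_space[OF A(1)]] ys[of n] by blast
  qed (use A C Q decrease_rate_nonneg[OF p] in \<open>auto simp: settled_def\<close>)
  then obtain n' where n': "n' \<le> settle_time (phase_length p Q) (card A)" "Lp_norm p (ys n') = 0"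
    using Lp_norm_nonneg[of p] by (auto intro: order_antisym)
  have "ys n' = 0" using haar_space_eq_0[OF p A(1)] ys n'(2) by blast
  then obtain j where j: "j \<le> n'" "xs j = 0" by (auto simp: ys_def split: if_splits)
  have "real j \<le> real (settle_time (phase_length p Q) (card A))" using j n' by simp
  also have "\<dots> \<le> 6 * (16 * decrease_const p * ln Q + 1) * 2 ^ card A"
    using phase_length_le[OF p Q1] decrease_const_ge_1[OF p] Q1 by (intro settle_time_bound) auto
  finally show "\<exists>n. real n \<le> 6 * (16 * decrease_const p * ln Q + 1) * 2 ^ card A \<and> xs n = 0"
    using j(2) by blast
qed

text \<open>For \<open>m \<ge> 2\<close> the terms \<open>ln 2 + ln m\<close> and
  \<open>m * ln m\<close> are each at most \<open>m * ln m\<close>, and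
  \<open>ln 2 \<le> ln m\<close> lets \<open>m * ln C\<close> be absorbed with factor
  \<open>ln C / ln 2\<close>.\<close>

lemma ln_settling_scale_le:
  fixes C :: real
  assumes "1 \<le> C" "2 \<le> m" and Q: "Q = 2 * (real m * (C * real m) ^ m)"
  shows "ln Q \<le> (2 + ln C / ln 2) * (real m * ln (real m))"
proof -
  have lm: "ln 2 \<le> ln (real m)" using assms by simp
  have l2: "0 < ln (2::real)" by simp
  have "ln C * ln 2 \<le> ln C * ln (real m)"
    using lm assms by (intro mult_left_mono) auto
  then have "ln C \<le> ln C / ln 2 * ln (real m)" using l2 by (simp add: field_simps)
  then have "real m * ln C \<le> real m * (ln C / ln 2 * ln (real m))" by (intro mult_left_mono) auto
  moreover have "2 * ln (real m) \<le> real m * ln (real m)"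
    using assms by (intro mult_right_mono) auto
  moreover have "ln Q = ln 2 + ln (real m) + real m * (ln C + ln (real m))"
    using assms by (simp add: Q ln_mult ln_realpow)
  ultimately show ?thesis using lm by (simp add: algebra_simps)
qed

theorem theorem4p4:
  fixes p :: real
  assumes "2 < p"
  shows "\<exists>K>0. \<forall>m\<ge>2. \<forall>A::nat set. card A = m \<longrightarrow>
    (\<forall>x \<in> haar_space p A.
       terminates_within (xga_select (Lp_norm p) (haar_dict p A)) (Lp_norm p) x
         (K * 2 ^ m * real m * ln (real m)) \<and>
       terminates_within (dga_select (haar_space p A) (Lp_norm p) (haar_dict p A)) (Lp_norm p) x
         (K * 2 ^ m * real m * ln (real m)))"
proof -
  define B where "B = 16 * decrease_const p"
  define c where "c = 2 + ln (reset_factor p) / ln 2"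
  \<comment> \<open>\<open>B * c\<close> comes from the logarithm of \<open>Q\<close>, and
    \<open>1 / ln 2\<close> absorbs the additive 1 left by rounding phase lengths, since
    \<open>ln 2 \<le> m * ln m\<close>.\<close>
  define K where "K = 6 * (B * c + 1 / ln 2)"
  have p: "2 \<le> p" using assms by simp
  have C: "1 \<le> reset_factor p" by (simp add: reset_factor_def)
  have B: "0 \<le> B" using decrease_const_ge_1[OF p] by (simp add: B_def)
  have c: "0 \<le> c" using C by (simp add: c_def)
  have "0 < K" unfolding K_def using mult_nonneg_nonneg[OF B c] by (simp add: add_nonneg_pos)
  moreover have "terminates_within (xga_select (Lp_norm p) (haar_dict p A)) (Lp_norm p) x (K * 2 ^ m * real m * ln (real m))
    \<and> terminates_within (dga_select (haar_space p A) (Lp_norm p) (haar_dict p A)) (Lp_norm p) x (K * 2 ^ m * real m * ln (real m))"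
    if m: "2 \<le> m" "card A = m" and x: "x \<in> haar_space p A" for m A x
  proof -
    define Q where "Q = 2 * (real m * (reset_factor p * real m) ^ m)"
    \<comment> \<open>Infinite sets have cardinality 0, so \<open>2 \<le> card A\<close> already
      forces finiteness.\<close>
    have A: "finite A" "A \<noteq> {}" using m by (auto intro: card_ge_0_finite)
    have "ln 2 \<le> ln (real m)" using m by simp
    also have "1 * ln (real m) \<le> real m * ln (real m)" using m by (intro mult_right_mono) auto
    finally have one: "1 \<le> 1 / ln 2 * (real m * ln (real m))" by (simp add: field_simps)
    have "ln Q \<le> c * (real m * ln (real m))"
      unfolding c_def using C m(1) Q_def by (rule ln_settling_scale_le)
    then have "B * ln Q \<le> B * (c * (real m * ln (real m)))" using B by (rule mult_left_mono)
    then have "B * ln Q + 1 \<le> (B * c + 1 / ln 2) * (real m * ln (real m))"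
      unfolding distrib_right mult.assoc using one by (rule add_mono)
    then have "6 * (B * ln Q + 1) * 2 ^ m \<le> 6 * ((B * c + 1 / ln 2) * (real m * ln (real m))) * 2 ^ m"
      by (intro mult_right_mono mult_left_mono) auto
    then have le: "6 * (B * ln Q + 1) * 2 ^ m \<le> K * 2 ^ m * real m * ln (real m)"
      by (simp add: K_def mult_ac)
    have mono: "terminates_within sel (Lp_norm p) x (6 * (B * ln Q + 1) * 2 ^ m)
      \<Longrightarrow> terminates_within sel (Lp_norm p) x (K * 2 ^ m * real m * ln (real m))" for sel
      unfolding terminates_within_def using le by (meson order_trans)
    have "Q = 2 * (real (card A) * (reset_factor p * real (card A)) ^ card A)" using m by (simp add: Q_def)
    from terminates_within_good_step[OF p A x _ this] show ?thesis
      using good_step_xga[OF p A(1)] good_step_dga[OF p A(1)] mono m by (simp add: B_def)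
  qed
  ultimately show ?thesis by blast
qed

end
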